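(* There exist seven dimensional manifolds $M$ with an integrable quaternionic contact (qc) structure such that the fundamental $4$-form $\Omega$ is closed, $d\Omega=0$, but the torsion endomorphism of the Biquard connection does not vanish (that is, the endomorphisms $T_\xi=T(\xi,\cdot)_{|H}:H\to H$, $\xi\in V$, are not all zero).
   Context: A quaternionic contact (qc) structure on a $7$-dimensional manifold $M$ consists of a distribution $H\subset TM$ of rank $4$ (the horizontal space) with a metric $g$ on $H$ such that: (i) $H$ is locally the common kernel of three differential $1$-forms $\eta_1,\eta_2,\eta_3$; (ii) $H$ is equipped with a rank-three bundle $\mathbb{Q}$ of endomorphisms of $H$ locally generated by almost complex structures $I_1,I_2,I_3$ on $H$ with $I_1I_2=-I_2I_1=I_3$, $I_1I_2I_3=-\mathrm{id}_{|H}$, and $g(I_r\cdot,I_r\cdot)=g(\cdot,\cdot)$; (iii) $2g(I_rX,Y)=d\eta_r(X,Y)$ for $r=1,2,3$ and $X,Y\in H$. In dimension $7$ the qc structure is called integrable if there are (local) vector fields $\xi_1,\xi_2,\xi_3$ with $$\eta_s(\xi_k)=\delta_{sk},\qquad (\xi_s\lrcorner d\eta_s)_{|H}=0,\qquad (\xi_s\lrcorner d\eta_k)_{|H}=-(\xi_k\lrcorner d\eta_s)_{|H}\qquad (1\le s,k\le 3),$$ where $\lrcorner$ is interior multiplication. Then $V$ (the vertical distribution) is the complement of $H$ in $TM$ locally spanned by $\xi_1,\xi_2,\xi_3$, and $g$ is extended to $TM$ by requiring $V\perp H$ and $g(\xi_r,\xi_k)=\delta_{rk}$. Biquard connection. For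 an integrable qc structure in dimension $7$ it is the unique linear connection $\nabla$ on $M$, with torsion $T$, such that: (i) $\nabla$ preserves the splitting $TM=H\oplus V$ and the $Sp(1)Sp(1)$-structure on $H$, i.e. $\nabla g=0$ and $\nabla\sigma\in\Gamma(\mathbb{Q})$ for every section $\sigma\in\Gamma(\mathbb{Q})$; (ii) $T(X,Y)=-[X,Y]_{|V}$ for $X,Y\in H$; (iii) for $\xi\in V$ the endomorphism $T(\xi,\cdot)_{|H}$ of $H$ lies in $(sp(1)\oplus sp(1))^{\perp}\subset gl(4)$, where one $sp(1)$ is spanned by $I_1,I_2,I_3$, the other consists of the $g$-skew endomorphisms of $H$ commuting with $I_1,I_2,I_3$, and $\perp$ is with respect to $\langle A,B\rangle=\sum_i g(A(e_i),B(e_i))$ for an orthonormal basis $e_1,\dots,e_4$ of $H$; (iv) $\nabla\varphi=0$, where $\varphi:V\to\mathbb{Q}$ is the natural identification $\xi_r\mapsto I_r$. The torsion endomorphism is $T_\xi=T(\xi,\cdot)_{|H}:H\to H$, $\xi\in V$. Fundamental $4$-form. Let $\omega_r(X,Y)=g(I_rX,Y)$ for $X,Y\in H$, i.e. $2\omega_r=d\eta_r{}_{|H}$, extended to $TM$ by $\xi\lrcorner\omega_r=0$ for $\xi\in V$. The (globally defined) fundamental $4$-form is $\Omega=\omega_1\wedge\omega_1+\omega_2\wedge\omega_2+\omega_3\wedge\omega_3$. *)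

theory Defs
  imports "HOL-Analysis.Analysis"
begin

section \<open>Smooth maps between Euclidean spaces\<close>

primrec Ck_on :: "nat \<Rightarrow> 'e::euclidean_space set \<Rightarrow> ('e \<Rightarrow> 'f::real_normed_vector) \<Rightarrow> bool" where
  "Ck_on 0 S f \<longleftrightarrow> continuous_on S f"
| "Ck_on (Suc k) S f \<longleftrightarrow>
     (\<forall>x\<in>S. f differentiable (at x)) \<and> (\<forall>v. Ck_on k S (\<lambda>x. frechet_derivative f (at x) v))"

text \<open>Meaningful only for open \<open>S\<close>.\<close>
definition smooth_on :: "'e::euclidean_space set \<Rightarrow> ('e \<Rightarrow> 'f::real_normed_vector) \<Rightarrow> bool" where
  "smooth_on S f \<longleftrightarrow> (\<forall>k. Ck_on k S f)"


section \<open>Smooth manifolds and their tangent spaces\<close>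

text \<open>A chart is its domain together with its coordinate map; outside the domain the coordinate
  map is irrelevant.\<close>
type_synonym ('a, 'e) chart = "'a set \<times> ('a \<Rightarrow> 'e)"

definition chart_inv :: "('a, 'e) chart \<Rightarrow> 'e \<Rightarrow> 'a" where
  "chart_inv c = inv_into (fst c) (snd c)"

definition smooth_manifold :: "'a topology \<Rightarrow> ('a, 'e::euclidean_space) chart set \<Rightarrow> bool" where
  "smooth_manifold M A \<longleftrightarrow>
     Hausdorff_space M \<and> second_countable M \<and>
     (\<Union>c\<in>A. fst c) = topspace M \<and>
     (\<forall>c\<in>A. openin M (fst c) \<and> open (snd c ` fst c) \<and>
        homeomorphic_map (subtopology M (fst c)) (top_of_set (snd c ` fst c)) (snd c)) \<and>
     (\<forall>c\<in>A. \<forall>d\<in>A. smooth_on (snd c ` (fst c \<inter> fst d)) (snd d \<circ> chart_inv c))"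

text \<open>The tangent space at \<open>p\<close> is modelled by the type \<open>'e\<close>: a tangent vector is given by its
  components in one fixed chart \<open>chart_at A p\<close> around \<open>p\<close>.\<close>
definition chart_at :: "('a, 'e) chart set \<Rightarrow> 'a \<Rightarrow> ('a, 'e) chart" where
  "chart_at A p = (SOME c. c \<in> A \<and> p \<in> fst c)"

text \<open>The differential at \<open>p\<close> of a map from the manifold to a normed space. If \<open>f = snd c\<close> for a
  chart \<open>c\<close>, it maps a tangent vector at \<open>p\<close> to its components in \<open>c\<close>.\<close>
definition mfd_diff :: "('a, 'e::euclidean_space) chart set \<Rightarrow> ('a \<Rightarrow> 'f::real_normed_vector)
    \<Rightarrow> 'a \<Rightarrow> 'e \<Rightarrow> 'f" where
  "mfd_diff A f p = (let c = chart_at A p in frechet_derivative (f \<circ> chart_inv c) (at (snd c p)))"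

text \<open>The differential at \<open>y\<close> of the parametrization inverse to \<open>c\<close>: it maps components in \<open>c\<close> to
  the tangent vector at \<open>chart_inv c y\<close>.\<close>
definition chart_inv_diff :: "('a, 'e::euclidean_space) chart set \<Rightarrow> ('a, 'e) chart
    \<Rightarrow> 'e \<Rightarrow> 'e \<Rightarrow> 'e" where
  "chart_inv_diff A c y =
     frechet_derivative (snd (chart_at A (chart_inv c y)) \<circ> chart_inv c) (at y)"

definition smooth_fun :: "'a topology \<Rightarrow> ('a, 'e::euclidean_space) chart set \<Rightarrow> 'a set
    \<Rightarrow> ('a \<Rightarrow> real) \<Rightarrow> bool" where
  "smooth_fun M A W f \<longleftrightarrow>
     openin M W \<and> (\<forall>c\<in>A. smooth_on (snd c ` (fst c \<inter> W)) (f \<circ> chart_inv c))"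


section \<open>Vector fields\<close>

text \<open>A local vector field is a total function that is only relevant on an open set \<open>W\<close>.
  \<open>vf_rep A c X\<close> is its coordinate representation in the chart \<open>c\<close>.\<close>

definition vf_rep :: "('a, 'e::euclidean_space) chart set \<Rightarrow> ('a, 'e) chart \<Rightarrow> ('a \<Rightarrow> 'e)
    \<Rightarrow> 'e \<Rightarrow> 'e" where
  "vf_rep A c X y = mfd_diff A (snd c) (chart_inv c y) (X (chart_inv c y))"

definition smooth_vf :: "'a topology \<Rightarrow> ('a, 'e::euclidean_space) chart set \<Rightarrow> 'a set
    \<Rightarrow> ('a \<Rightarrow> 'e) \<Rightarrow> bool" where
  "smooth_vf M A W X \<longleftrightarrow>
     openin M W \<and> (\<forall>c\<in>A. smooth_on (snd c ` (fst c \<inter> W)) (vf_rep A c X))"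

definition smooth_section :: "'a topology \<Rightarrow> ('a, 'e::euclidean_space) chart set
    \<Rightarrow> ('a \<Rightarrow> 'e set) \<Rightarrow> 'a set \<Rightarrow> ('a \<Rightarrow> 'e) \<Rightarrow> bool" where
  "smooth_section M A E W X \<longleftrightarrow> smooth_vf M A W X \<and> (\<forall>q\<in>W. X q \<in> E q)"

definition lie_bracket :: "('a, 'e::euclidean_space) chart set \<Rightarrow> ('a \<Rightarrow> 'e) \<Rightarrow> ('a \<Rightarrow> 'e)
    \<Rightarrow> 'a \<Rightarrow> 'e" where
  "lie_bracket A X Y p =
     (let c = chart_at A p; x = snd c p in
        frechet_derivative (vf_rep A c Y) (at x) (vf_rep A c X x)
        - frechet_derivative (vf_rep A c X) (at x) (vf_rep A c Y x))"


section \<open>Differential forms\<close>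

text \<open>The value of a \<open>k\<close>-form at a point is a function of lists of \<open>k\<close> tangent vectors.\<close>

definition alternating_form :: "nat \<Rightarrow> ('e::real_vector list \<Rightarrow> real) \<Rightarrow> bool" where
  "alternating_form k a \<longleftrightarrow>
     (\<forall>vs. length vs = k \<longrightarrow>
        (\<forall>i<k. linear (\<lambda>v. a (vs[i := v]))) \<and>
        (\<forall>i<k. \<forall>j<k. i \<noteq> j \<and> vs ! i = vs ! j \<longrightarrow> a vs = 0))"

definition form_rep :: "('a, 'e::euclidean_space) chart set \<Rightarrow> ('a, 'e) chart
    \<Rightarrow> ('a \<Rightarrow> 'e list \<Rightarrow> real) \<Rightarrow> 'e \<Rightarrow> 'e list \<Rightarrow> real" where
  "form_rep A c \<omega> y vs = \<omega> (chart_inv c y) (map (chart_inv_diff A c y) vs)"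

definition smooth_form :: "'a topology \<Rightarrow> ('a, 'e::euclidean_space) chart set \<Rightarrow> 'a set \<Rightarrow> nat
    \<Rightarrow> ('a \<Rightarrow> 'e list \<Rightarrow> real) \<Rightarrow> bool" where
  "smooth_form M A W k \<omega> \<longleftrightarrow>
     openin M W \<and> (\<forall>q\<in>W. alternating_form k (\<omega> q)) \<and>
     (\<forall>c\<in>A. \<forall>vs. length vs = k \<longrightarrow>
        smooth_on (snd c ` (fst c \<inter> W)) (\<lambda>y. form_rep A c \<omega> y vs))"

text \<open>Exterior derivative without normalizing factor, so that
  \<open>d\<eta>(X,Y) = X \<eta>(Y) - Y \<eta>(X) - \<eta>([X,Y])\<close> for a 1-form \<open>\<eta>\<close>. It is computed in the chart in whose
  components the tangent vectors at \<open>p\<close> are given.\<close>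
definition ext_deriv :: "('a, 'e::euclidean_space) chart set \<Rightarrow> ('a \<Rightarrow> 'e list \<Rightarrow> real)
    \<Rightarrow> 'a \<Rightarrow> 'e list \<Rightarrow> real" where
  "ext_deriv A \<omega> p vs =
     (let c = chart_at A p in
        \<Sum>i<length vs. (-1) ^ i *
          frechet_derivative (\<lambda>y. form_rep A c \<omega> y (take i vs @ drop (Suc i) vs))
            (at (snd c p)) (vs ! i))"

definition wedge :: "nat \<Rightarrow> nat \<Rightarrow> ('e list \<Rightarrow> real) \<Rightarrow> ('e list \<Rightarrow> real) \<Rightarrow> 'e list \<Rightarrow> real" where
  "wedge k l a b vs =
     (\<Sum>\<pi> | \<pi> permutes {..<k + l}. of_int (sign \<pi>)
        * a (map (\<lambda>i. vs ! \<pi> i) [0..<k]) * b (map (\<lambda>i. vs ! \<pi> i) [k..<k + l]))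
     / (fact k * fact l)"


section \<open>Linear connections and torsion\<close>

text \<open>\<open>nab p v Y\<close> is the derivative at \<open>p\<close>, in the direction \<open>v\<close>, of a vector field \<open>Y\<close> defined
  near \<open>p\<close>.\<close>
definition linear_connection :: "'a topology \<Rightarrow> ('a, 'e::euclidean_space) chart set
    \<Rightarrow> ('a \<Rightarrow> 'e \<Rightarrow> ('a \<Rightarrow> 'e) \<Rightarrow> 'e) \<Rightarrow> bool" where
  "linear_connection M A nab \<longleftrightarrow>
     (\<forall>W Y. smooth_vf M A W Y \<longrightarrow> (\<forall>p\<in>W. linear (\<lambda>v. nab p v Y))) \<and>
     (\<forall>W Y Z. smooth_vf M A W Y \<and> smooth_vf M A W Z \<longrightarrow>
        (\<forall>p\<in>W. \<forall>v. nab p v (\<lambda>q. Y q + Z q) = nab p v Y + nab p v Z)) \<and>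
     (\<forall>W f Y. smooth_fun M A W f \<and> smooth_vf M A W Y \<longrightarrow>
        (\<forall>p\<in>W. \<forall>v. nab p v (\<lambda>q. f q *\<^sub>R Y q) = f p *\<^sub>R nab p v Y + mfd_diff A f p v *\<^sub>R Y p)) \<and>
     (\<forall>W Y Z. smooth_vf M A W Y \<and> smooth_vf M A W Z \<and> (\<forall>q\<in>W. Y q = Z q) \<longrightarrow>
        (\<forall>p\<in>W. \<forall>v. nab p v Y = nab p v Z)) \<and>
     (\<forall>W X Y. smooth_vf M A W X \<and> smooth_vf M A W Y \<longrightarrow>
        smooth_vf M A W (\<lambda>p. nab p (X p) Y))"

text \<open>The torsion \<open>T(u,v)\<close> of tangent vectors \<open>u\<close>, \<open>v\<close> at \<open>p\<close> is the common value at \<open>p\<close> of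
  \<open>\<nabla>\<^sub>X Y - \<nabla>\<^sub>Y X - [X,Y]\<close> for all local extensions \<open>X\<close>, \<open>Y\<close> of \<open>u\<close>, \<open>v\<close>; it is well defined for
  every linear connection, since this expression is tensorial.\<close>
definition torsion :: "'a topology \<Rightarrow> ('a, 'e::euclidean_space) chart set
    \<Rightarrow> ('a \<Rightarrow> 'e \<Rightarrow> ('a \<Rightarrow> 'e) \<Rightarrow> 'e) \<Rightarrow> 'a \<Rightarrow> 'e \<Rightarrow> 'e \<Rightarrow> 'e" where
  "torsion M A nab p u v =
     (THE t. \<forall>W X Y. p \<in> W \<and> smooth_vf M A W X \<and> smooth_vf M A W Y \<and> X p = u \<and> Y p = v \<longrightarrow>
        nab p (X p) Y - nab p (Y p) X - lie_bracket A X Y p = t)"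


section \<open>Linear algebra on a subspace\<close>

definition inner_product_on :: "'e::real_vector set \<Rightarrow> ('e \<Rightarrow> 'e \<Rightarrow> real) \<Rightarrow> bool" where
  "inner_product_on S b \<longleftrightarrow>
     (\<forall>x\<in>S. \<forall>y\<in>S. b x y = b y x) \<and>
     (\<forall>x\<in>S. \<forall>y\<in>S. \<forall>z\<in>S. b (x + y) z = b x z + b y z) \<and>
     (\<forall>c. \<forall>x\<in>S. \<forall>y\<in>S. b (c *\<^sub>R x) y = c * b x y) \<and>
     (\<forall>x\<in>S. x \<noteq> 0 \<longrightarrow> b x x > 0)"

text \<open>Endomorphisms of a subspace \<open>S\<close> are represented by total functions; only their values on \<open>S\<close>
  matter.\<close>
definition endo_on :: "'e::real_vector set \<Rightarrow> ('e \<Rightarrow> 'e) \<Rightarrow> bool" where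
  "endo_on S B \<longleftrightarrow>
     (\<forall>x\<in>S. B x \<in> S) \<and> (\<forall>x\<in>S. \<forall>y\<in>S. B (x + y) = B x + B y) \<and>
     (\<forall>c. \<forall>x\<in>S. B (c *\<^sub>R x) = c *\<^sub>R B x)"

definition proj_along :: "'e::real_vector set \<Rightarrow> 'e set \<Rightarrow> 'e \<Rightarrow> 'e" where
  "proj_along S T v = (THE w. w \<in> S \<and> v - w \<in> T)"


section \<open>Quaternionic contact structures on 7-manifolds\<close>

text \<open>\<open>H\<close> is the horizontal distribution, \<open>g p\<close> is relevant on \<open>H p\<close> only, and \<open>Q p\<close> is the space of
  all functions whose restriction to \<open>H p\<close> lies in the fibre of the bundle of endomorphisms.
  Local objects indexed by \<open>r = 1, 2, 3\<close> are functions of \<open>r :: nat\<close>.\<close>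

type_synonym 'a metric = "'a \<Rightarrow> real^7 \<Rightarrow> real^7 \<Rightarrow> real"
type_synonym 'a distribution = "'a \<Rightarrow> (real^7) set"
type_synonym 'a endo_field = "'a \<Rightarrow> real^7 \<Rightarrow> real^7"
type_synonym 'a endo_bundle = "'a \<Rightarrow> (real^7 \<Rightarrow> real^7) set"
type_synonym 'a form = "'a \<Rightarrow> (real^7) list \<Rightarrow> real"

definition smooth_endo :: "'a topology \<Rightarrow> ('a, real^7) chart set \<Rightarrow> 'a distribution \<Rightarrow> 'a set
    \<Rightarrow> 'a endo_field \<Rightarrow> bool" where
  "smooth_endo M A H W \<sigma> \<longleftrightarrow>
     openin M W \<and> (\<forall>q\<in>W. endo_on (H q) (\<sigma> q)) \<and>
     (\<forall>W' X. W' \<subseteq> W \<and> smooth_section M A H W' X \<longrightarrow> smooth_vf M A W' (\<lambda>q. \<sigma> q (X q)))"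

definition qc_frame :: "'a topology \<Rightarrow> ('a, real^7) chart set \<Rightarrow> 'a distribution \<Rightarrow> 'a metric
    \<Rightarrow> 'a endo_bundle \<Rightarrow> 'a set \<Rightarrow> (nat \<Rightarrow> 'a form) \<Rightarrow> (nat \<Rightarrow> 'a endo_field) \<Rightarrow> bool" where
  "qc_frame M A H g Q W \<eta> I \<longleftrightarrow>
     openin M W \<and>
     (\<forall>r\<in>{1,2,3}. smooth_form M A W 1 (\<eta> r) \<and> smooth_endo M A H W (I r)) \<and>
     (\<forall>q\<in>W.
        H q = {v. \<forall>r\<in>{1,2,3}. \<eta> r q [v] = 0} \<and>
        Q q = {B. \<exists>a :: nat \<Rightarrow> real. \<forall>X\<in>H q. B X = (\<Sum>r\<in>{1,2,3}. a r *\<^sub>R I r q X)} \<and>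
        (\<forall>X\<in>H q.
           (\<forall>r\<in>{1,2,3}. I r q (I r q X) = - X) \<and>
           I 1 q (I 2 q X) = I 3 q X \<and> I 2 q (I 1 q X) = - I 3 q X \<and>
           I 1 q (I 2 q (I 3 q X)) = - X) \<and>
        (\<forall>r\<in>{1,2,3}. \<forall>X\<in>H q. \<forall>Y\<in>H q.
           g q (I r q X) (I r q Y) = g q X Y \<and>
           2 * g q (I r q X) Y = ext_deriv A (\<eta> r) q [X, Y]))"

definition qc_structure :: "'a topology \<Rightarrow> ('a, real^7) chart set \<Rightarrow> 'a distribution \<Rightarrow> 'a metric
    \<Rightarrow> 'a endo_bundle \<Rightarrow> bool" where
  "qc_structure M A H g Q \<longleftrightarrow>
     smooth_manifold M A \<and>
     (\<forall>p\<in>topspace M. subspace (H p) \<and> dim (H p) = 4 \<and> inner_product_on (H p) (g p)) \<and>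
     (\<forall>W X Y. smooth_section M A H W X \<and> smooth_section M A H W Y \<longrightarrow>
        smooth_fun M A W (\<lambda>q. g q (X q) (Y q))) \<and>
     (\<forall>p\<in>topspace M. \<exists>W \<eta> I. p \<in> W \<and> qc_frame M A H g Q W \<eta> I)"

definition reeb_frame :: "'a topology \<Rightarrow> ('a, real^7) chart set \<Rightarrow> 'a distribution \<Rightarrow> 'a metric
    \<Rightarrow> 'a endo_bundle \<Rightarrow> 'a set \<Rightarrow> (nat \<Rightarrow> 'a form) \<Rightarrow> (nat \<Rightarrow> 'a endo_field)
    \<Rightarrow> (nat \<Rightarrow> 'a \<Rightarrow> real^7) \<Rightarrow> bool" where
  "reeb_frame M A H g Q W \<eta> I \<xi> \<longleftrightarrow>
     qc_frame M A H g Q W \<eta> I \<and>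
     (\<forall>s\<in>{1,2,3}. smooth_vf M A W (\<xi> s)) \<and>
     (\<forall>q\<in>W. \<forall>s\<in>{1,2,3}. \<forall>k\<in>{1,2,3}.
        \<eta> s q [\<xi> k q] = (if s = k then 1 else 0) \<and>
        (\<forall>X\<in>H q. ext_deriv A (\<eta> s) q [\<xi> s q, X] = 0 \<and>
           ext_deriv A (\<eta> k) q [\<xi> s q, X] = - ext_deriv A (\<eta> s) q [\<xi> k q, X]))"

definition integrable_qc_structure :: "'a topology \<Rightarrow> ('a, real^7) chart set \<Rightarrow> 'a distribution
    \<Rightarrow> 'a metric \<Rightarrow> 'a endo_bundle \<Rightarrow> bool" where
  "integrable_qc_structure M A H g Q \<longleftrightarrow>
     qc_structure M A H g Q \<and>
     (\<forall>p\<in>topspace M. \<exists>W \<eta> I \<xi>. p \<in> W \<and> reeb_frame M A H g Q W \<eta> I \<xi>)"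

text \<open>The vertical distribution \<open>V\<close>, the extension \<open>G\<close> of \<open>g\<close> to the tangent bundle, and the natural
  identification \<open>\<phi>\<close> of \<open>V\<close> with the bundle of endomorphisms. Each is determined at \<open>p\<close> by any
  Reeb frame around \<open>p\<close> and does not depend on its choice.\<close>

definition vertical_distribution :: "'a topology \<Rightarrow> ('a, real^7) chart set \<Rightarrow> 'a distribution
    \<Rightarrow> 'a metric \<Rightarrow> 'a endo_bundle \<Rightarrow> 'a distribution \<Rightarrow> bool" where
  "vertical_distribution M A H g Q V \<longleftrightarrow>
     (\<forall>p\<in>topspace M. \<exists>W \<eta> I \<xi>. p \<in> W \<and> reeb_frame M A H g Q W \<eta> I \<xi> \<and>
        (\<forall>q\<in>W. V q = span {\<xi> 1 q, \<xi> 2 q, \<xi> 3 q}))"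

definition extended_metric :: "'a topology \<Rightarrow> ('a, real^7) chart set \<Rightarrow> 'a distribution
    \<Rightarrow> 'a metric \<Rightarrow> 'a endo_bundle \<Rightarrow> 'a metric \<Rightarrow> bool" where
  "extended_metric M A H g Q G \<longleftrightarrow>
     (\<forall>p\<in>topspace M. \<exists>W \<eta> I \<xi>. p \<in> W \<and> reeb_frame M A H g Q W \<eta> I \<xi> \<and>
        (\<forall>q\<in>W. inner_product_on UNIV (G q) \<and>
           (\<forall>X\<in>H q. \<forall>Y\<in>H q. G q X Y = g q X Y) \<and>
           (\<forall>r\<in>{1,2,3}. \<forall>X\<in>H q. G q (\<xi> r q) X = 0) \<and>
           (\<forall>r\<in>{1,2,3}. \<forall>k\<in>{1,2,3}. G q (\<xi> r q) (\<xi> k q) = (if r = k then 1 else 0))))"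

definition natural_identification :: "'a topology \<Rightarrow> ('a, real^7) chart set \<Rightarrow> 'a distribution
    \<Rightarrow> 'a metric \<Rightarrow> 'a endo_bundle \<Rightarrow> ('a \<Rightarrow> real^7 \<Rightarrow> real^7 \<Rightarrow> real^7) \<Rightarrow> bool" where
  "natural_identification M A H g Q \<phi> \<longleftrightarrow>
     (\<forall>p\<in>topspace M. \<exists>W \<eta> I \<xi>. p \<in> W \<and> reeb_frame M A H g Q W \<eta> I \<xi> \<and>
        (\<forall>q\<in>W. \<forall>a :: nat \<Rightarrow> real. \<forall>X\<in>H q.
           \<phi> q (\<Sum>r\<in>{1,2,3}. a r *\<^sub>R \<xi> r q) X = (\<Sum>r\<in>{1,2,3}. a r *\<^sub>R I r q X)))"


section \<open>The fundamental 4-form\<close>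

definition kahler_form :: "'a distribution \<Rightarrow> 'a distribution \<Rightarrow> 'a metric \<Rightarrow> 'a endo_field
    \<Rightarrow> 'a form" where
  "kahler_form H V g J q vs =
     g q (J q (proj_along (H q) (V q) (vs ! 0))) (proj_along (H q) (V q) (vs ! 1))"

definition fundamental_form :: "'a topology \<Rightarrow> ('a, real^7) chart set \<Rightarrow> 'a distribution
    \<Rightarrow> 'a metric \<Rightarrow> 'a endo_bundle \<Rightarrow> 'a distribution \<Rightarrow> 'a form \<Rightarrow> bool" where
  "fundamental_form M A H g Q V \<Omega> \<longleftrightarrow>
     (\<forall>p\<in>topspace M. \<exists>W \<eta> I. p \<in> W \<and> qc_frame M A H g Q W \<eta> I \<and>
        (\<forall>q\<in>W. \<forall>vs. length vs = 4 \<longrightarrow>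
           \<Omega> q vs = (\<Sum>r\<in>{1,2,3}.
             wedge 2 2 (kahler_form H V g (I r) q) (kahler_form H V g (I r) q) vs)))"

definition closed_form :: "'a topology \<Rightarrow> ('a, 'e::euclidean_space) chart set \<Rightarrow> nat
    \<Rightarrow> ('a \<Rightarrow> 'e list \<Rightarrow> real) \<Rightarrow> bool" where
  "closed_form M A k \<omega> \<longleftrightarrow>
     (\<forall>p\<in>topspace M. \<forall>vs. length vs = Suc k \<longrightarrow> ext_deriv A \<omega> p vs = 0)"


section \<open>The Biquard connection\<close>

text \<open>The second copy of \<open>sp(1)\<close> in \<open>gl(H p)\<close>.\<close>
definition sp1_commuting :: "'a distribution \<Rightarrow> 'a metric \<Rightarrow> 'a endo_bundle \<Rightarrow> 'a
    \<Rightarrow> (real^7 \<Rightarrow> real^7) set" where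
  "sp1_commuting H g Q p =
     {B. endo_on (H p) B \<and>
         (\<forall>X\<in>H p. \<forall>Y\<in>H p. g p (B X) Y = - g p X (B Y)) \<and>
         (\<forall>J\<in>Q p. \<forall>X\<in>H p. B (J X) = J (B X))}"

text \<open>The orthogonal complement in \<open>gl(S)\<close>, for a 4-dimensional \<open>S\<close> with inner product \<open>b\<close>; the
  pairing does not depend on the orthonormal basis.\<close>
definition gl_perp :: "'e::real_vector set \<Rightarrow> ('e \<Rightarrow> 'e \<Rightarrow> real) \<Rightarrow> ('e \<Rightarrow> 'e) set
    \<Rightarrow> ('e \<Rightarrow> 'e) set" where
  "gl_perp S b \<A> =
     {B. endo_on S B \<and>
         (\<exists>e :: nat \<Rightarrow> 'e.
            (\<forall>i<4. e i \<in> S) \<and>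
            (\<forall>i<4. \<forall>j<4. b (e i) (e j) = (if i = j then 1 else 0)) \<and>
            (\<forall>C\<in>\<A>. (\<Sum>i<4. b (B (e i)) (C (e i))) = 0))}"

text \<open>\<open>(\<nabla>\<^sub>v \<sigma>)(X p)\<close> for a local section \<open>\<sigma>\<close> of endomorphisms of \<open>H\<close> and a local section \<open>X\<close> of \<open>H\<close>.\<close>
definition endo_cov_deriv :: "('a \<Rightarrow> 'e \<Rightarrow> ('a \<Rightarrow> 'e) \<Rightarrow> 'e) \<Rightarrow> 'a \<Rightarrow> 'e \<Rightarrow> ('a \<Rightarrow> 'e \<Rightarrow> 'e)
    \<Rightarrow> ('a \<Rightarrow> 'e) \<Rightarrow> 'e::real_vector" where
  "endo_cov_deriv nab p v \<sigma> X = nab p v (\<lambda>q. \<sigma> q (X q)) - \<sigma> p (nab p v X)"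

definition preserves_distribution :: "'a topology \<Rightarrow> ('a, 'e::euclidean_space) chart set
    \<Rightarrow> ('a \<Rightarrow> 'e \<Rightarrow> ('a \<Rightarrow> 'e) \<Rightarrow> 'e) \<Rightarrow> ('a \<Rightarrow> 'e set) \<Rightarrow> bool" where
  "preserves_distribution M A nab E \<longleftrightarrow>
     (\<forall>W Y. smooth_section M A E W Y \<longrightarrow> (\<forall>p\<in>W. \<forall>v. nab p v Y \<in> E p))"

definition parallel_metric :: "'a topology \<Rightarrow> ('a, 'e::euclidean_space) chart set
    \<Rightarrow> ('a \<Rightarrow> 'e \<Rightarrow> ('a \<Rightarrow> 'e) \<Rightarrow> 'e) \<Rightarrow> ('a \<Rightarrow> 'e \<Rightarrow> 'e \<Rightarrow> real) \<Rightarrow> bool" where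
  "parallel_metric M A nab G \<longleftrightarrow>
     (\<forall>W Y Z. smooth_vf M A W Y \<and> smooth_vf M A W Z \<longrightarrow>
        (\<forall>p\<in>W. \<forall>v. mfd_diff A (\<lambda>q. G q (Y q) (Z q)) p v
            = G p (nab p v Y) (Z p) + G p (Y p) (nab p v Z)))"

definition preserves_endo_bundle :: "'a topology \<Rightarrow> ('a, real^7) chart set
    \<Rightarrow> ('a \<Rightarrow> real^7 \<Rightarrow> ('a \<Rightarrow> real^7) \<Rightarrow> real^7) \<Rightarrow> 'a distribution \<Rightarrow> 'a endo_bundle \<Rightarrow> bool" where
  "preserves_endo_bundle M A nab H Q \<longleftrightarrow>
     (\<forall>W \<sigma>. smooth_endo M A H W \<sigma> \<and> (\<forall>q\<in>W. \<sigma> q \<in> Q q) \<longrightarrow>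
        (\<forall>p\<in>W. \<forall>v. \<exists>B\<in>Q p. \<forall>W' X. p \<in> W' \<and> W' \<subseteq> W \<and> smooth_section M A H W' X \<longrightarrow>
            endo_cov_deriv nab p v \<sigma> X = B (X p)))"

definition parallel_identification :: "'a topology \<Rightarrow> ('a, real^7) chart set
    \<Rightarrow> ('a \<Rightarrow> real^7 \<Rightarrow> ('a \<Rightarrow> real^7) \<Rightarrow> real^7) \<Rightarrow> 'a distribution \<Rightarrow> 'a distribution
    \<Rightarrow> ('a \<Rightarrow> real^7 \<Rightarrow> real^7 \<Rightarrow> real^7) \<Rightarrow> bool" where
  "parallel_identification M A nab H V \<phi> \<longleftrightarrow>
     (\<forall>W \<zeta> X. smooth_section M A V W \<zeta> \<and> smooth_section M A H W X \<longrightarrow>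
        (\<forall>p\<in>W. \<forall>v. endo_cov_deriv nab p v (\<lambda>q. \<phi> q (\<zeta> q)) X = \<phi> p (nab p v \<zeta>) (X p)))"

definition biquard_connection :: "'a topology \<Rightarrow> ('a, real^7) chart set \<Rightarrow> 'a distribution
    \<Rightarrow> 'a metric \<Rightarrow> 'a endo_bundle \<Rightarrow> 'a distribution \<Rightarrow> 'a metric
    \<Rightarrow> ('a \<Rightarrow> real^7 \<Rightarrow> real^7 \<Rightarrow> real^7)
    \<Rightarrow> ('a \<Rightarrow> real^7 \<Rightarrow> ('a \<Rightarrow> real^7) \<Rightarrow> real^7) \<Rightarrow> bool" where
  "biquard_connection M A H g Q V G \<phi> nab \<longleftrightarrow>
     linear_connection M A nab \<and>
     preserves_distribution M A nab H \<and> preserves_distribution M A nab V \<and>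
     parallel_metric M A nab G \<and> preserves_endo_bundle M A nab H Q \<and>
     (\<forall>W X Y. smooth_section M A H W X \<and> smooth_section M A H W Y \<longrightarrow>
        (\<forall>p\<in>W. torsion M A nab p (X p) (Y p)
            = - proj_along (V p) (H p) (lie_bracket A X Y p))) \<and>
     (\<forall>p\<in>topspace M. \<forall>\<xi>\<in>V p.
        torsion M A nab p \<xi> \<in>
          gl_perp (H p) (g p)
            {\<lambda>X. B X + C X |B C. B \<in> Q p \<and> C \<in> sp1_commuting H g Q p}) \<and>
     parallel_identification M A nab H V \<phi>"

end

theory Submission
  imports Defs
begin

text \<open>
  The fundamental 4-form is six times the volume form of \<open>H\<close>, extended by zero on \<open>V\<close>, because
  the three forms \<open>\<omega>\<^sub>r\<close> have the same square on a space of dimension four. It is closed exactly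
  when \<open>V\<close> is integrable and the vertical flows preserve this transverse volume. The torsion
  endomorphism \<open>T\<^sub>\<xi>\<close>, on the other hand, is minus the symmetric part of the action of \<open>\<xi>\<close> on \<open>H\<close>
  and measures how the vertical flows change the transverse metric. A flow can preserve volume
  without preserving the metric: a shear does. So it suffices to find a structure whose
  vertical fields act on \<open>H\<close> by shears.

  Such a structure exists among the left-invariant ones on a solvable Lie group. The Lie algebra is
  spanned by \<open>e\<^sub>1, \<dots>, e\<^sub>7\<close> with
  \<open>[e\<^sub>1,e\<^sub>2] = -4e\<^sub>2-2e\<^sub>5\<close>, \<open>[e\<^sub>3,e\<^sub>4] = -2e\<^sub>5\<close>, \<open>[e\<^sub>1,e\<^sub>3] = 4e\<^sub>3-2e\<^sub>6\<close>, \<open>[e\<^sub>2,e\<^sub>4] = 2e\<^sub>3+2e\<^sub>6\<close>,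
  \<open>[e\<^sub>1,e\<^sub>4] = -4e\<^sub>4-2e\<^sub>7\<close>, \<open>[e\<^sub>2,e\<^sub>3] = 6e\<^sub>4-2e\<^sub>7\<close>, \<open>[e\<^sub>1,e\<^sub>6] = -6e\<^sub>3\<close>, \<open>[e\<^sub>2,e\<^sub>6] = 6e\<^sub>4+6e\<^sub>7\<close>,
  \<open>[e\<^sub>1,e\<^sub>7] = -6e\<^sub>4\<close>, \<open>[e\<^sub>2,e\<^sub>7] = -6e\<^sub>3-6e\<^sub>6\<close>, \<open>[e\<^sub>6,e\<^sub>7] = 6e\<^sub>5\<close>. Here \<open>e\<^sub>1, \<dots>, e\<^sub>4\<close> is an
  orthonormal basis of \<open>H\<close> and \<open>e\<^sub>5, e\<^sub>6, e\<^sub>7\<close> are the Reeb fields. The latter span a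
  Heisenberg subalgebra, in which \<open>e\<^sub>6\<close> and \<open>e\<^sub>7\<close> act on \<open>H\<close> by nilpotent, not skew, endomorphisms
  that map \<open>e\<^sub>1, e\<^sub>2\<close> to combinations of \<open>e\<^sub>3, e\<^sub>4\<close>.

  The group is \<open>\<real>\<^sup>7\<close> with a polynomial frame \<open>frame\<close>. The lemmas \<open>lie_bracket_frame\<close>,
  \<open>ext_deriv_coframe\<close> and \<open>torsion_frame_connection\<close> reduce every differential condition to an
  identity between bilinear maps on \<open>\<real>\<^sup>7\<close>: the structure constants \<open>bracket\<close>, the quaternionic
  multiplication \<open>quat\<close> and the Christoffel symbols \<open>christoffel\<close> of the Biquard connection. Two
  conditions are settled otherwise. The form is closed because it has constant coefficients
  (\<open>hvol_coframe\<close>). The bundle of endomorphisms is preserved because the identification with \<open>V\<close>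
  is parallel (\<open>christoffel_quat\<close>).
\<close>

section \<open>Calculus of smooth maps\<close>

lemma Ck_on_open_cong:
  assumes "open S" "\<And>x. x \<in> S \<Longrightarrow> f x = g x" "Ck_on k S f"
  shows "Ck_on k S g"
  using assms
proof (induction k arbitrary: f g)
  case 0
  then show ?case using continuous_on_cong[of S S f g] by simp
next
  case (Suc k)
  have d: "f differentiable (at x)" if "x \<in> S" for x using Suc.prems(3) that by simp
  have "g differentiable (at x)" if "x \<in> S" for x
    using d[OF that] has_derivative_transform_within_open[OF _ Suc.prems(1) that, of f _ UNIV g]
      Suc.prems(2) unfolding differentiable_def by blast
  moreover have "Ck_on k S (\<lambda>x. frechet_derivative g (at x) v)" for v
  proof (rule Suc.IH[OF Suc.prems(1)])
    show "Ck_on k S (\<lambda>x. frechet_derivative f (at x) v)" using Suc.prems(3) by simp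
    show "frechet_derivative f (at x) v = frechet_derivative g (at x) v" if "x \<in> S" for x
      using frechet_derivative_transform_within_open[OF d[OF that] Suc.prems(1) that] Suc.prems(2)
      by simp
  qed
  ultimately show ?case by simp
qed

lemma Ck_on_SucD: "Ck_on (Suc k) S f \<Longrightarrow> Ck_on k S f"
proof (induction k arbitrary: f)
  case 0
  then show ?case
    by (auto intro!: differentiable_imp_continuous_on differentiable_at_imp_differentiable_on)
next
  case (Suc k)
  have 1: "\<forall>x\<in>S. f differentiable (at x)" using Suc.prems unfolding Ck_on.simps(2)[of "Suc k"] by simp
  have "Ck_on (Suc k) S (\<lambda>x. frechet_derivative f (at x) v)" for v
    using Suc.prems unfolding Ck_on.simps(2)[of "Suc k"] by simp
  then have "Ck_on k S (\<lambda>x. frechet_derivative f (at x) v)" for v by (rule Suc.IH)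
  with 1 show ?case by simp
qed

lemma Ck_on_subset: "T \<subseteq> S \<Longrightarrow> Ck_on k S f \<Longrightarrow> Ck_on k T f"
  by (induction k arbitrary: f) (auto intro: continuous_on_subset)

lemma Ck_on_const: "Ck_on k S (\<lambda>x. a)"
  by (induction k arbitrary: a) auto

lemma Ck_on_ident: "Ck_on k S (\<lambda>x. x)"
  by (cases k) (auto simp: Ck_on_const)

lemma Ck_on_add:
  assumes "open S" "Ck_on k S f" "Ck_on k S g"
  shows "Ck_on k S (\<lambda>x. f x + g x)"
  using assms(2,3)
proof (induction k arbitrary: f g)
  case 0
  then show ?case by (simp add: continuous_on_add)
next
  case (Suc k)
  have d: "f differentiable (at x)" "g differentiable (at x)" if "x \<in> S" for x
    using Suc.prems that by auto
  have "Ck_on k S (\<lambda>x. frechet_derivative (\<lambda>x. f x + g x) (at x) v)" for v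
  proof (rule Ck_on_open_cong[OF assms(1)])
    show "Ck_on k S (\<lambda>x. frechet_derivative f (at x) v + frechet_derivative g (at x) v)"
      using Suc.prems by (intro Suc.IH) auto
    show "frechet_derivative f (at x) v + frechet_derivative g (at x) v
        = frechet_derivative (\<lambda>x. f x + g x) (at x) v" if "x \<in> S" for x
    proof -
      have "((\<lambda>x. f x + g x) has_derivative
          (\<lambda>v. frechet_derivative f (at x) v + frechet_derivative g (at x) v)) (at x)"
        using d[OF that] unfolding frechet_derivative_works by (rule has_derivative_add)
      from frechet_derivative_at[OF this] show ?thesis by (rule fun_cong)
    qed
  qed
  moreover have "\<forall>x\<in>S. (\<lambda>x. f x + g x) differentiable (at x)"
    using d by (auto intro: differentiable_add)
  ultimately show ?case by simp
qed

text \<open>The derivative of the product is a sum of two products, each with one factor differentiated;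
  the other factor has to be demoted from class \<open>k + 1\<close> to class \<open>k\<close> before the induction
  hypothesis applies.\<close>
lemma Ck_on_bounded_bilinear:
  assumes "bounded_bilinear m" "open S" "Ck_on k S f" "Ck_on k S g"
  shows "Ck_on k S (\<lambda>x. m (f x) (g x))"
  using assms(3,4)
proof (induction k arbitrary: f g)
  case 0
  then show ?case by (simp add: bounded_bilinear.continuous_on[OF assms(1)])
next
  case (Suc k)
  have d: "f differentiable (at x)" "g differentiable (at x)" if "x \<in> S" for x
    using Suc.prems that by auto
  have D: "((\<lambda>x. m (f x) (g x)) has_derivative
      (\<lambda>v. m (f x) (frechet_derivative g (at x) v) + m (frechet_derivative f (at x) v) (g x)))
      (at x)" if "x \<in> S" for x
    using d[OF that] bounded_bilinear.FDERIV[OF assms(1)] unfolding frechet_derivative_works by blast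
  have "Ck_on k S (\<lambda>x. frechet_derivative (\<lambda>x. m (f x) (g x)) (at x) v)" for v
  proof (rule Ck_on_open_cong[OF assms(2)])
    have "Ck_on k S f" "Ck_on k S g" using Suc.prems Ck_on_SucD by blast+
    then show "Ck_on k S (\<lambda>x. m (f x) (frechet_derivative g (at x) v)
        + m (frechet_derivative f (at x) v) (g x))"
      using Suc.prems by (intro Ck_on_add[OF assms(2)] Suc.IH) auto
    show "m (f x) (frechet_derivative g (at x) v) + m (frechet_derivative f (at x) v) (g x)
        = frechet_derivative (\<lambda>x. m (f x) (g x)) (at x) v" if "x \<in> S" for x
      using frechet_derivative_at[OF D[OF that]] by (rule fun_cong)
  qed
  moreover have "\<forall>x\<in>S. (\<lambda>x. m (f x) (g x)) differentiable (at x)"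
    using D differentiable_def by blast
  ultimately show ?case by simp
qed

lemma smooth_on_open_cong:
  "open S \<Longrightarrow> (\<And>x. x \<in> S \<Longrightarrow> f x = g x) \<Longrightarrow> smooth_on S f \<Longrightarrow> smooth_on S g"
  unfolding smooth_on_def by (blast intro: Ck_on_open_cong)

lemma smooth_on_subset: "T \<subseteq> S \<Longrightarrow> smooth_on S f \<Longrightarrow> smooth_on T f"
  unfolding smooth_on_def using Ck_on_subset by blast

lemma smooth_on_const: "smooth_on S (\<lambda>x. a)"
  unfolding smooth_on_def by (simp add: Ck_on_const)

lemma smooth_on_ident: "smooth_on S (\<lambda>x. x)"
  unfolding smooth_on_def by (simp add: Ck_on_ident)

lemma smooth_on_add: "open S \<Longrightarrow> smooth_on S f \<Longrightarrow> smooth_on S g \<Longrightarrow> smooth_on S (\<lambda>x. f x + g x)"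
  unfolding smooth_on_def using Ck_on_add by blast

lemma smooth_on_sum:
  "open S \<Longrightarrow> (\<And>i. i \<in> J \<Longrightarrow> smooth_on S (f i)) \<Longrightarrow> smooth_on S (\<lambda>x. \<Sum>i\<in>J. f i x)"
  by (induction J rule: infinite_finite_induct) (auto intro: smooth_on_const smooth_on_add)

lemma smooth_on_bounded_bilinear:
  "bounded_bilinear m \<Longrightarrow> open S \<Longrightarrow> smooth_on S f \<Longrightarrow> smooth_on S g
    \<Longrightarrow> smooth_on S (\<lambda>x. m (f x) (g x))"
  unfolding smooth_on_def using Ck_on_bounded_bilinear by blast

lemmas smooth_on_scaleR = smooth_on_bounded_bilinear[OF bounded_bilinear_scaleR]
lemmas smooth_on_inner = smooth_on_bounded_bilinear[OF bounded_bilinear_inner]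
lemmas smooth_on_mult = smooth_on_bounded_bilinear[OF bounded_bilinear_mult]

lemma smooth_on_imp_differentiable: "smooth_on S f \<Longrightarrow> x \<in> S \<Longrightarrow> f differentiable (at x)"
  unfolding smooth_on_def using Ck_on.simps(2) by blast

lemma smooth_on_frechet_derivative:
  "smooth_on S f \<Longrightarrow> smooth_on S (\<lambda>x. frechet_derivative f (at x) v)"
  unfolding smooth_on_def using Ck_on.simps(2) by blast

lemma linear_eq_sum_Basis:
  fixes f :: "'e::euclidean_space \<Rightarrow> 'f::real_vector"
  assumes "linear f"
  shows "f u = (\<Sum>b\<in>Basis. (u \<bullet> b) *\<^sub>R f b)"
proof -
  have "f u = f (\<Sum>b\<in>Basis. (u \<bullet> b) *\<^sub>R b)" by (simp add: euclidean_representation)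
  then show ?thesis by (simp only: linear_sum[OF assms] linear_scale[OF assms])
qed

text \<open>A linear map is the combination of its values on the basis, so a family that is smooth on each
  fixed vector is smooth on every smooth map.\<close>
lemma smooth_on_linear_family:
  fixes F :: "'e::euclidean_space \<Rightarrow> 'a::euclidean_space \<Rightarrow> 'f::real_normed_vector"
  assumes "open S" "\<And>x. linear (F x)" "\<And>u. smooth_on S (\<lambda>x. F x u)" "smooth_on S Y"
  shows "smooth_on S (\<lambda>x. F x (Y x))"
proof (rule smooth_on_open_cong[OF assms(1)])
  show "(\<Sum>b\<in>Basis. (Y x \<bullet> b) *\<^sub>R F x b) = F x (Y x)" for x
    by (rule linear_eq_sum_Basis[OF assms(2), symmetric])
  show "smooth_on S (\<lambda>x. \<Sum>b\<in>Basis. (Y x \<bullet> b) *\<^sub>R F x b)"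
    by (intro smooth_on_sum smooth_on_scaleR smooth_on_inner smooth_on_const assms)
qed

lemma smooth_on_linear_compose:
  fixes h :: "'a::euclidean_space \<Rightarrow> 'f::real_normed_vector"
  shows "open S \<Longrightarrow> linear h \<Longrightarrow> smooth_on S f \<Longrightarrow> smooth_on S (\<lambda>x. h (f x))"
  using smooth_on_linear_family[of S "\<lambda>_. h"] by (simp add: smooth_on_const)

lemma smooth_on_directional_derivative:
  assumes "open S" "smooth_on S f" "smooth_on S X"
  shows "smooth_on S (\<lambda>x. frechet_derivative f (at x) (X x))"
proof (rule smooth_on_open_cong[OF assms(1)])
  show "(\<Sum>b\<in>Basis. (X x \<bullet> b) *\<^sub>R frechet_derivative f (at x) b)
      = frechet_derivative f (at x) (X x)" if "x \<in> S" for x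
    using smooth_on_imp_differentiable[OF assms(2) that]
    by (intro linear_eq_sum_Basis[symmetric] linear_frechet_derivative)
  show "smooth_on S (\<lambda>x. \<Sum>b\<in>Basis. (X x \<bullet> b) *\<^sub>R frechet_derivative f (at x) b)"
    by (intro smooth_on_sum smooth_on_scaleR smooth_on_inner smooth_on_const
        smooth_on_frechet_derivative assms)
qed

text \<open>Product rule for a family of linear maps applied to a map. Expanding \<open>Y x\<close> in a basis reduces it to
  the product rule for scalar multiples of the fields \<open>F x b\<close> with fixed \<open>b\<close>.\<close>
lemma frechet_derivative_linear_family:
  fixes F :: "'e::euclidean_space \<Rightarrow> 'a::euclidean_space \<Rightarrow> 'f::real_normed_vector"
  assumes lin: "\<And>x. linear (F x)" and F: "\<And>u. (\<lambda>x. F x u) differentiable (at p)"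
    and Y: "Y differentiable (at p)"
  shows "((\<lambda>x. F x (Y x)) has_derivative
      (\<lambda>v. F p (frechet_derivative Y (at p) v) + frechet_derivative (\<lambda>x. F x (Y p)) (at p) v)) (at p)"
    (is "(_ has_derivative ?D) _")
proof -
  have dF: "((\<lambda>x. F x b) has_derivative frechet_derivative (\<lambda>x. F x b) (at p)) (at p)" for b
    using F frechet_derivative_works by blast
  have dY: "(Y has_derivative frechet_derivative Y (at p)) (at p)"
    using Y frechet_derivative_works by blast
  have "((\<lambda>x. \<Sum>b\<in>Basis. (Y p \<bullet> b) *\<^sub>R F x b) has_derivative
      (\<lambda>v. \<Sum>b\<in>Basis. (Y p \<bullet> b) *\<^sub>R frechet_derivative (\<lambda>x. F x b) (at p) v)) (at p)"
    by (intro has_derivative_sum has_derivative_scaleR_right dF)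
  moreover have "(\<lambda>x. \<Sum>b\<in>Basis. (Y p \<bullet> b) *\<^sub>R F x b) = (\<lambda>x. F x (Y p))"
    by (intro ext linear_eq_sum_Basis[OF lin, symmetric])
  ultimately have *: "frechet_derivative (\<lambda>x. F x (Y p)) (at p) =
      (\<lambda>v. \<Sum>b\<in>Basis. (Y p \<bullet> b) *\<^sub>R frechet_derivative (\<lambda>x. F x b) (at p) v)"
    using frechet_derivative_at by (metis (no_types, lifting))
  have "((\<lambda>x. \<Sum>b\<in>Basis. (Y x \<bullet> b) *\<^sub>R F x b) has_derivative
      (\<lambda>v. \<Sum>b\<in>Basis. (Y p \<bullet> b) *\<^sub>R frechet_derivative (\<lambda>x. F x b) (at p) v
        + (frechet_derivative Y (at p) v \<bullet> b) *\<^sub>R F p b)) (at p)"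
    by (intro has_derivative_sum has_derivative_scaleR dF has_derivative_inner_left dY)
  moreover have "(\<lambda>x. \<Sum>b\<in>Basis. (Y x \<bullet> b) *\<^sub>R F x b) = (\<lambda>x. F x (Y x))"
    by (intro ext linear_eq_sum_Basis[OF lin, symmetric])
  moreover have "(\<lambda>v. \<Sum>b\<in>Basis. (Y p \<bullet> b) *\<^sub>R frechet_derivative (\<lambda>x. F x b) (at p) v
        + (frechet_derivative Y (at p) v \<bullet> b) *\<^sub>R F p b) = ?D"
    by (simp add: sum.distrib * linear_eq_sum_Basis[OF lin, of p "frechet_derivative Y (at p) _"] add.commute)
  ultimately show ?thesis by simp
qed

lemma smooth_on_diff:
  fixes f g :: "'e::euclidean_space \<Rightarrow> 'f::euclidean_space"
  assumes "open S" "smooth_on S f" "smooth_on S g"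
  shows "smooth_on S (\<lambda>x. f x - g x)"
  using smooth_on_add[OF assms(1,2) smooth_on_linear_compose[OF assms(1) linear_uminus assms(3)]]
  by simp

lemma smooth_on_divide_const:
  "open S \<Longrightarrow> smooth_on S f \<Longrightarrow> smooth_on S (\<lambda>x. f x / a)" for a :: real
  using smooth_on_mult[OF _ _ smooth_on_const[of S "1 / a"]] by simp

section \<open>Euclidean space as a manifold\<close>

abbreviation std_atlas :: "('e::euclidean_space, 'e) chart set" where
  "std_atlas \<equiv> {(UNIV, id)}"

lemma chart_at_std_atlas [simp]: "chart_at std_atlas p = (UNIV, id)"
  unfolding chart_at_def by (rule some_equality) auto

lemma chart_inv_std [simp]: "chart_inv (UNIV, id) = id"
  unfolding chart_inv_def by (simp add: inv_id[unfolded id_def] id_def)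

lemma chart_inv_diff_std [simp]: "chart_inv_diff std_atlas (UNIV, id) y = id"
  unfolding chart_inv_diff_def by simp

lemma mfd_diff_std [simp]: "mfd_diff std_atlas f p = frechet_derivative f (at p)"
  unfolding mfd_diff_def by simp

lemma vf_rep_std [simp]: "vf_rep std_atlas (UNIV, id) X = X"
  unfolding vf_rep_def by simp

lemma form_rep_std [simp]: "form_rep std_atlas (UNIV, id) \<omega> = \<omega>"
  by (intro ext) (simp add: form_rep_def)

lemma smooth_fun_std [simp]: "smooth_fun euclidean std_atlas W f \<longleftrightarrow> open W \<and> smooth_on W f"
  unfolding smooth_fun_def by simp

lemma smooth_vf_std [simp]: "smooth_vf euclidean std_atlas W X \<longleftrightarrow> open W \<and> smooth_on W X"
  unfolding smooth_vf_def by simp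

lemma smooth_form_std:
  "smooth_form euclidean std_atlas W k \<omega> \<longleftrightarrow>
     open W \<and> (\<forall>q\<in>W. alternating_form k (\<omega> q)) \<and>
     (\<forall>vs. length vs = k \<longrightarrow> smooth_on W (\<lambda>y. \<omega> y vs))"
  unfolding smooth_form_def by simp

lemma lie_bracket_std:
  "lie_bracket std_atlas X Y p =
     frechet_derivative Y (at p) (X p) - frechet_derivative X (at p) (Y p)"
  unfolding lie_bracket_def by simp

lemma ext_deriv_std:
  "ext_deriv std_atlas \<omega> p vs =
     (\<Sum>i<length vs. (-1) ^ i *
        frechet_derivative (\<lambda>y. \<omega> y (take i vs @ drop (Suc i) vs)) (at p) (vs ! i))"
  unfolding ext_deriv_def by simp

lemma smooth_manifold_std: "smooth_manifold (euclidean :: 'e::euclidean_space topology) std_atlas"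
proof -
  obtain \<B> :: "'e set set" where B: "countable \<B>" "\<And>U. U \<in> \<B> \<Longrightarrow> open U"
      "\<And>S. open S \<Longrightarrow> \<exists>\<U>. \<U> \<subseteq> \<B> \<and> S = \<Union>\<U>"
    by (metis univ_second_countable)
  have "second_countable (euclidean :: 'e topology)"
    unfolding second_countable_def
  proof (intro exI[of _ \<B>] conjI ballI allI impI)
    fix U and x :: 'e assume "openin euclidean U \<and> x \<in> U"
    then obtain \<U> where "\<U> \<subseteq> \<B>" "U = \<Union>\<U>" "x \<in> U" using B(3)[of U] by auto
    then show "\<exists>V\<in>\<B>. x \<in> V \<and> V \<subseteq> U" by auto
  qed (use B in auto)
  moreover have "homeomorphic_map euclidean euclidean (id :: 'e \<Rightarrow> 'e)"
    by (simp add: homeomorphic_map_id)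
  moreover have "smooth_on UNIV (id :: 'e \<Rightarrow> 'e)"
    unfolding id_def by (rule smooth_on_ident)
  ultimately show ?thesis
    unfolding smooth_manifold_def by (simp add: Hausdorff_space_euclidean)
qed


section \<open>Frames with constant structure functions\<close>

text \<open>\<open>E p\<close> sends a vector \<open>u\<close> of constants to the value at \<open>p\<close> of the field with components \<open>u\<close>,
  and \<open>\<theta> p\<close> reads off components. With constant structure functions \<open>c\<close> the fields \<open>E \<cdot> u\<close>
  form a Lie algebra with bracket \<open>c\<close>, as the left-invariant fields on a Lie group do. All
  geometry of tensors and connections with constant components then becomes algebra of
  bilinear maps on one vector space.\<close>

locale invariant_frame =
  fixes E \<theta> :: "'e::euclidean_space \<Rightarrow> 'e \<Rightarrow> 'e" and c :: "'e \<Rightarrow> 'e \<Rightarrow> 'e"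
  assumes linear_frame: "linear (E p)"
    and coframe_frame [simp]: "\<theta> p (E p u) = u"
    and frame_coframe [simp]: "E p (\<theta> p v) = v"
    and smooth_frame: "smooth_on UNIV (\<lambda>q. E q u)"
    and smooth_coframe: "smooth_on UNIV (\<lambda>q. \<theta> q v)"
    and frame_bracket: "frechet_derivative (\<lambda>q. E q v) (at p) (E p u)
        - frechet_derivative (\<lambda>q. E q u) (at p) (E p v) = E p (c u v)"
begin

lemma linear_coframe: "linear (\<theta> p)"
proof (rule linearI)
  show "\<theta> p (v + w) = \<theta> p v + \<theta> p w" for v w
  proof -
    have "\<theta> p (v + w) = \<theta> p (E p (\<theta> p v) + E p (\<theta> p w))" by simp
    also have "\<dots> = \<theta> p (E p (\<theta> p v + \<theta> p w))" by (simp only: linear_add[OF linear_frame])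
    finally show ?thesis by simp
  qed
  show "\<theta> p (r *\<^sub>R v) = r *\<^sub>R \<theta> p v" for r v
  proof -
    have "\<theta> p (r *\<^sub>R v) = \<theta> p (r *\<^sub>R E p (\<theta> p v))" by simp
    also have "\<dots> = \<theta> p (E p (r *\<^sub>R \<theta> p v))" by (simp only: linear_scale[OF linear_frame])
    finally show ?thesis by simp
  qed
qed

lemmas frame_add = linear_add[OF linear_frame]
lemmas frame_diff = linear_diff[OF linear_frame]
lemmas frame_neg = linear_neg[OF linear_frame]
lemmas frame_scale = linear_scale[OF linear_frame]
lemmas frame_zero [simp] = linear_0[OF linear_frame]
lemmas coframe_add = linear_add[OF linear_coframe]
lemmas coframe_diff = linear_diff[OF linear_coframe]
lemmas coframe_neg = linear_neg[OF linear_coframe]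
lemmas coframe_scale = linear_scale[OF linear_coframe]
lemmas coframe_zero [simp] = linear_0[OF linear_coframe]

lemma frame_eq_iff: "E p u = v \<longleftrightarrow> u = \<theta> p v"
  by (metis coframe_frame frame_coframe)

lemma eq_frame_iff: "v = E p u \<longleftrightarrow> \<theta> p v = u"
  by (metis coframe_frame frame_coframe)

lemma smooth_on_frame: "open W \<Longrightarrow> smooth_on W y \<Longrightarrow> smooth_on W (\<lambda>q. E q (y q))"
  by (rule smooth_on_linear_family[OF _ linear_frame smooth_on_subset[OF _ smooth_frame]]) auto

lemma smooth_on_coframe: "open W \<Longrightarrow> smooth_on W Y \<Longrightarrow> smooth_on W (\<lambda>q. \<theta> q (Y q))"
  by (rule smooth_on_linear_family[OF _ linear_coframe smooth_on_subset[OF _ smooth_coframe]]) auto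

lemma differentiable_coframe:
  "open W \<Longrightarrow> smooth_on W Y \<Longrightarrow> p \<in> W \<Longrightarrow> (\<lambda>q. \<theta> q (Y q)) differentiable (at p)"
  using smooth_on_coframe smooth_on_imp_differentiable by blast

text \<open>Differentiating \<open>Y = E (\<theta> Y)\<close> by the product rule leaves the derivatives of the components
  and a term in the derivatives of the frame; the antisymmetrization of the latter is \<open>c\<close>.\<close>
lemma lie_bracket_frame:
  assumes "open W" "smooth_on W X" "smooth_on W Y" "p \<in> W"
  shows "lie_bracket std_atlas X Y p =
    E p (frechet_derivative (\<lambda>q. \<theta> q (Y q)) (at p) (X p)
      - frechet_derivative (\<lambda>q. \<theta> q (X q)) (at p) (Y p) + c (\<theta> p (X p)) (\<theta> p (Y p)))"
proof -
  have D: "frechet_derivative Z (at p) v = E p (frechet_derivative (\<lambda>q. \<theta> q (Z q)) (at p) v)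
      + frechet_derivative (\<lambda>q. E q (\<theta> p (Z p))) (at p) v"
    if Z: "smooth_on W Z" for Z v
  proof -
    have "((\<lambda>q. E q (\<theta> q (Z q))) has_derivative
       (\<lambda>v. E p (frechet_derivative (\<lambda>q. \<theta> q (Z q)) (at p) v)
         + frechet_derivative (\<lambda>q. E q (\<theta> p (Z p))) (at p) v)) (at p)"
      by (rule frechet_derivative_linear_family[OF linear_frame
            smooth_on_imp_differentiable[OF smooth_frame UNIV_I]
            differentiable_coframe[OF assms(1) Z assms(4)]])
    then have "(Z has_derivative
       (\<lambda>v. E p (frechet_derivative (\<lambda>q. \<theta> q (Z q)) (at p) v)
         + frechet_derivative (\<lambda>q. E q (\<theta> p (Z p))) (at p) v)) (at p)"
      by simp
    from frechet_derivative_at[OF this, symmetric] show ?thesis by (rule fun_cong)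
  qed
  have "frechet_derivative (\<lambda>q. E q (\<theta> p (Y p))) (at p) (X p)
      - frechet_derivative (\<lambda>q. E q (\<theta> p (X p))) (at p) (Y p) = E p (c (\<theta> p (X p)) (\<theta> p (Y p)))"
    using frame_bracket[of "\<theta> p (Y p)" p "\<theta> p (X p)"] by simp
  then show ?thesis
    unfolding lie_bracket_std D[OF assms(2)] D[OF assms(3)]
    by (simp add: frame_add frame_diff algebra_simps)
qed

text \<open>The Maurer--Cartan equation. The derivative of \<open>\<theta>\<close> is obtained by differentiating
  \<open>E (\<theta> w) = w\<close> for a constant \<open>w\<close>.\<close>
lemma ext_deriv_coframe:
  assumes l: "linear l"
  shows "ext_deriv std_atlas (\<lambda>q vs. l (\<theta> q (vs ! 0))) p [u, v] = - l (c (\<theta> p u) (\<theta> p v))"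
proof -
  have lb: "bounded_linear l" using l linear_conv_bounded_linear by blast
  have D: "frechet_derivative (\<lambda>q. l (\<theta> q w)) (at p) x
      = - l (\<theta> p (frechet_derivative (\<lambda>q. E q (\<theta> p w)) (at p) x))" for w x
  proof -
    have d: "(\<lambda>q. \<theta> q w) differentiable (at p)"
      by (rule smooth_on_imp_differentiable[OF smooth_coframe UNIV_I])
    have "((\<lambda>q. E q (\<theta> q w)) has_derivative
       (\<lambda>x. E p (frechet_derivative (\<lambda>q. \<theta> q w) (at p) x)
         + frechet_derivative (\<lambda>q. E q (\<theta> p w)) (at p) x)) (at p)"
      by (rule frechet_derivative_linear_family[OF linear_frame
            smooth_on_imp_differentiable[OF smooth_frame UNIV_I] d])
    then have "((\<lambda>q. w) has_derivative
       (\<lambda>x. E p (frechet_derivative (\<lambda>q. \<theta> q w) (at p) x)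
         + frechet_derivative (\<lambda>q. E q (\<theta> p w)) (at p) x)) (at p)"
      by simp
    from frechet_derivative_at[OF this]
    have "E p (frechet_derivative (\<lambda>q. \<theta> q w) (at p) x)
        + frechet_derivative (\<lambda>q. E q (\<theta> p w)) (at p) x = 0"
      by (simp add: fun_eq_iff)
    then have "E p (frechet_derivative (\<lambda>q. \<theta> q w) (at p) x)
        = - frechet_derivative (\<lambda>q. E q (\<theta> p w)) (at p) x"
      by (simp add: eq_neg_iff_add_eq_0)
    then have "frechet_derivative (\<lambda>q. \<theta> q w) (at p) x
        = - \<theta> p (frechet_derivative (\<lambda>q. E q (\<theta> p w)) (at p) x)"
      by (simp add: frame_eq_iff coframe_neg)
    moreover have "frechet_derivative (\<lambda>q. l (\<theta> q w)) (at p) x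
        = l (frechet_derivative (\<lambda>q. \<theta> q w) (at p) x)"
      using frechet_derivative_at[OF bounded_linear.has_derivative[OF lb
            d[unfolded frechet_derivative_works]], symmetric]
      by (rule fun_cong)
    ultimately show ?thesis by (simp add: linear_neg[OF l])
  qed
  have "ext_deriv std_atlas (\<lambda>q vs. l (\<theta> q (vs ! 0))) p [u, v]
      = frechet_derivative (\<lambda>q. l (\<theta> q v)) (at p) u - frechet_derivative (\<lambda>q. l (\<theta> q u)) (at p) v"
    by (simp add: ext_deriv_std numeral_2_eq_2)
  also have "\<dots> = - l (\<theta> p (frechet_derivative (\<lambda>q. E q (\<theta> p v)) (at p) (E p (\<theta> p u))
      - frechet_derivative (\<lambda>q. E q (\<theta> p u)) (at p) (E p (\<theta> p v))))"
    by (simp add: D coframe_diff linear_diff[OF l])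
  finally show ?thesis by (simp only: frame_bracket coframe_frame)
qed

text \<open>The connection with constant Christoffel symbols \<open>\<Gamma>\<close> in the frame.\<close>
definition frame_connection :: "('e \<Rightarrow> 'e \<Rightarrow> 'e) \<Rightarrow> 'e \<Rightarrow> 'e \<Rightarrow> ('e \<Rightarrow> 'e) \<Rightarrow> 'e" where
  "frame_connection \<Gamma> p v Y =
     E p (frechet_derivative (\<lambda>q. \<theta> q (Y q)) (at p) v + \<Gamma> (\<theta> p v) (\<theta> p (Y p)))"

lemma frame_connection_cong:
  assumes "open W" "smooth_on W Y" "\<And>q. q \<in> W \<Longrightarrow> Y q = Z q" "p \<in> W"
  shows "frame_connection \<Gamma> p v Y = frame_connection \<Gamma> p v Z"
proof -
  have "frechet_derivative (\<lambda>q. \<theta> q (Y q)) (at p) = frechet_derivative (\<lambda>q. \<theta> q (Z q)) (at p)"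
    using assms by (intro frechet_derivative_transform_within_open[OF differentiable_coframe, of W]) auto
  then show ?thesis
    using assms(3,4) unfolding frame_connection_def by simp
qed

lemma linear_connection_frame:
  assumes "bilinear \<Gamma>"
  shows "linear_connection euclidean std_atlas (frame_connection \<Gamma>)"
proof -
  have \<Gamma>1: "linear (\<lambda>u. \<Gamma> u y)" and \<Gamma>2: "linear (\<Gamma> u)" for u y
    using assms unfolding bilinear_def by auto
  show ?thesis
    unfolding linear_connection_def smooth_vf_std smooth_fun_std mfd_diff_std
  proof (intro conjI allI impI ballI; (elim conjE)?)
    fix W and Y :: "'e \<Rightarrow> 'e" and p assume W: "open W" "smooth_on W Y" "p \<in> W"
    have "linear (\<lambda>v. frechet_derivative (\<lambda>q. \<theta> q (Y q)) (at p) v)"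
      using linear_frechet_derivative[OF differentiable_coframe[OF W]] .
    moreover have "linear (\<lambda>v. \<Gamma> (\<theta> p v) (\<theta> p (Y p)))"
      using linear_compose[OF linear_coframe \<Gamma>1] by (simp add: o_def)
    ultimately have "linear (\<lambda>v. frechet_derivative (\<lambda>q. \<theta> q (Y q)) (at p) v
        + \<Gamma> (\<theta> p v) (\<theta> p (Y p)))"
      by (rule linear_compose_add)
    from linear_compose[OF this linear_frame]
    show "linear (\<lambda>v. frame_connection \<Gamma> p v Y)"
      unfolding frame_connection_def by (simp add: o_def)
  next
    fix W and Y Z :: "'e \<Rightarrow> 'e" and p v
    assume W: "open W" "smooth_on W Y" "smooth_on W Z" "p \<in> W"
    have "((\<lambda>q. \<theta> q (Y q) + \<theta> q (Z q)) has_derivative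
       (\<lambda>v. frechet_derivative (\<lambda>q. \<theta> q (Y q)) (at p) v
          + frechet_derivative (\<lambda>q. \<theta> q (Z q)) (at p) v)) (at p)"
      using W by (intro has_derivative_add) (simp_all flip: frechet_derivative_works add: differentiable_coframe)
    from fun_cong[OF frechet_derivative_at[OF this], symmetric]
    have "frechet_derivative (\<lambda>q. \<theta> q (Y q + Z q)) (at p) v
       = frechet_derivative (\<lambda>q. \<theta> q (Y q)) (at p) v + frechet_derivative (\<lambda>q. \<theta> q (Z q)) (at p) v"
      by (simp add: coframe_add)
    then show "frame_connection \<Gamma> p v (\<lambda>q. Y q + Z q)
        = frame_connection \<Gamma> p v Y + frame_connection \<Gamma> p v Z"
      unfolding frame_connection_def
      by (simp add: coframe_add linear_add[OF \<Gamma>2] frame_add algebra_simps)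
  next
    fix W and f :: "'e \<Rightarrow> real" and Y :: "'e \<Rightarrow> 'e" and p v
    assume W: "open W" "smooth_on W f" "smooth_on W Y" "p \<in> W"
    have "((\<lambda>q. f q *\<^sub>R \<theta> q (Y q)) has_derivative
       (\<lambda>v. f p *\<^sub>R frechet_derivative (\<lambda>q. \<theta> q (Y q)) (at p) v
          + frechet_derivative f (at p) v *\<^sub>R \<theta> p (Y p))) (at p)"
      using W smooth_on_imp_differentiable[OF W(2,4)]
      by (intro has_derivative_scaleR) (simp_all flip: frechet_derivative_works add: differentiable_coframe)
    from fun_cong[OF frechet_derivative_at[OF this], symmetric]
    have "frechet_derivative (\<lambda>q. \<theta> q (f q *\<^sub>R Y q)) (at p) v
       = f p *\<^sub>R frechet_derivative (\<lambda>q. \<theta> q (Y q)) (at p) v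
         + frechet_derivative f (at p) v *\<^sub>R \<theta> p (Y p)"
      by (simp add: coframe_scale)
    then show "frame_connection \<Gamma> p v (\<lambda>q. f q *\<^sub>R Y q)
        = f p *\<^sub>R frame_connection \<Gamma> p v Y + frechet_derivative f (at p) v *\<^sub>R Y p"
      unfolding frame_connection_def
      by (simp add: coframe_scale linear_scale[OF \<Gamma>2] frame_add frame_scale algebra_simps)
  next
    fix W and Y Z :: "'e \<Rightarrow> 'e" and p v
    assume W: "open W" "smooth_on W Y" "smooth_on W Z" "\<forall>q\<in>W. Y q = Z q" "p \<in> W"
    then show "frame_connection \<Gamma> p v Y = frame_connection \<Gamma> p v Z"
      by (intro frame_connection_cong[of W]) auto
  next
    fix W and X Y :: "'e \<Rightarrow> 'e" assume W: "open W" "smooth_on W X" "smooth_on W Y"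
    note smooth_\<theta> = smooth_on_coframe[OF W(1)]
    have "smooth_on W (\<lambda>p. \<Gamma> (\<theta> p (X p)) y)" for y
      by (rule smooth_on_linear_compose[OF W(1) \<Gamma>1 smooth_\<theta>[OF W(2)]])
    then have "smooth_on W (\<lambda>p. \<Gamma> (\<theta> p (X p)) (\<theta> p (Y p)))"
      by (rule smooth_on_linear_family[OF W(1) \<Gamma>2 _ smooth_\<theta>[OF W(3)]])
    then show "smooth_on W (\<lambda>p. frame_connection \<Gamma> p (X p) Y)"
      unfolding frame_connection_def
      by (intro smooth_on_frame[OF W(1)] smooth_on_add[OF W(1)]
          smooth_on_directional_derivative[OF W(1) smooth_\<theta>[OF W(3)] W(2)])
  qed
qed

text \<open>The derivatives of the components of the two fields cancel, so every extension of the tangent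
  vectors gives the same value; the extensions with constant components show that one exists.\<close>
lemma torsion_frame_connection:
  assumes "bilinear \<Gamma>"
  shows "torsion euclidean std_atlas (frame_connection \<Gamma>) p u v =
    E p (\<Gamma> (\<theta> p u) (\<theta> p v) - \<Gamma> (\<theta> p v) (\<theta> p u) - c (\<theta> p u) (\<theta> p v))" (is "_ = ?t")
proof -
  have main: "frame_connection \<Gamma> p (X p) Y - frame_connection \<Gamma> p (Y p) X
      - lie_bracket std_atlas X Y p = ?t"
    if "p \<in> W" "open W" "smooth_on W X" "smooth_on W Y" "X p = u" "Y p = v" for W X Y
    unfolding lie_bracket_frame[OF that(2-4,1)] frame_connection_def that(5,6)
    by (simp add: frame_add frame_diff algebra_simps)
  define X Y where "X q = E q (\<theta> p u)" and "Y q = E q (\<theta> p v)" for q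
  have XY: "smooth_on UNIV X" "smooth_on UNIV Y" "X p = u" "Y p = v"
    unfolding X_def Y_def by (simp_all add: smooth_frame)
  show ?thesis
    unfolding torsion_def smooth_vf_std
  proof (rule the_equality)
    show "\<forall>W X Y. p \<in> W \<and> (open W \<and> smooth_on W X) \<and> (open W \<and> smooth_on W Y) \<and> X p = u \<and> Y p = v \<longrightarrow>
        frame_connection \<Gamma> p (X p) Y - frame_connection \<Gamma> p (Y p) X - lie_bracket std_atlas X Y p = ?t"
      using main by blast
    fix t
    assume "\<forall>W X Y. p \<in> W \<and> (open W \<and> smooth_on W X) \<and> (open W \<and> smooth_on W Y) \<and> X p = u \<and> Y p = v \<longrightarrow>
        frame_connection \<Gamma> p (X p) Y - frame_connection \<Gamma> p (Y p) X - lie_bracket std_atlas X Y p = t"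
    from this[rule_format, of UNIV X Y] main[of UNIV X Y] XY show "t = ?t" by simp
  qed
qed

text \<open>A subspace is the orthogonal complement of its orthogonal complement, that is, it is cut out by
  equations \<open>x \<bullet> w = 0\<close>, which can be differentiated.\<close>
lemma frechet_derivative_in_subspace:
  fixes f :: "'e \<Rightarrow> 'e"
  assumes "subspace S" "open W" "p \<in> W" "f differentiable (at p)" "\<And>q. q \<in> W \<Longrightarrow> f q \<in> S"
  shows "frechet_derivative f (at p) v \<in> S"
proof -
  have "frechet_derivative f (at p) v \<bullet> w = 0" if w: "w \<in> orthogonal_comp S" for w
  proof -
    have f0: "0 = f q \<bullet> w" if "q \<in> W" for q
      using assms(5)[OF that] w unfolding orthogonal_comp_def orthogonal_def by auto
    have "((\<lambda>q. 0) has_derivative (\<lambda>v. 0)) (at p)" by simp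
    from has_derivative_transform_within_open[OF this assms(2,3) f0]
    have "((\<lambda>q. f q \<bullet> w) has_derivative (\<lambda>v. 0)) (at p)" .
    moreover have "((\<lambda>q. f q \<bullet> w) has_derivative (\<lambda>v. frechet_derivative f (at p) v \<bullet> w)) (at p)"
      using assms(4) unfolding frechet_derivative_works by (rule has_derivative_inner_left)
    ultimately have "(\<lambda>v. frechet_derivative f (at p) v \<bullet> w) = (\<lambda>v. 0)"
      using has_derivative_unique by blast
    then show ?thesis by (rule fun_cong)
  qed
  then have "frechet_derivative f (at p) v \<in> orthogonal_comp (orthogonal_comp S)"
    unfolding orthogonal_comp_def orthogonal_def by (simp add: inner_commute)
  then show ?thesis by (simp add: orthogonal_comp_self assms(1))
qed

lemma coframe_frame_connection:
  "\<theta> p (frame_connection \<Gamma> p v Y)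
    = frechet_derivative (\<lambda>q. \<theta> q (Y q)) (at p) v + \<Gamma> (\<theta> p v) (\<theta> p (Y p))"
  unfolding frame_connection_def by simp

lemma preserves_distribution_frame:
  assumes "subspace S" "\<And>u s. s \<in> S \<Longrightarrow> \<Gamma> u s \<in> S"
  shows "preserves_distribution euclidean std_atlas (frame_connection \<Gamma>) (\<lambda>p. {v. \<theta> p v \<in> S})"
  unfolding preserves_distribution_def smooth_section_def smooth_vf_std mem_Collect_eq
    coframe_frame_connection
  by (blast intro: subspace_add[OF assms(1)] frechet_derivative_in_subspace[OF assms(1)]
      differentiable_coframe assms(2))

lemma parallel_metric_frame:
  assumes "\<And>u v w. \<Gamma> u v \<bullet> w = - (v \<bullet> \<Gamma> u w)"
  shows "parallel_metric euclidean std_atlas (frame_connection \<Gamma>) (\<lambda>p v w. \<theta> p v \<bullet> \<theta> p w)"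
  unfolding parallel_metric_def smooth_vf_std mfd_diff_std
proof (intro allI impI ballI, elim conjE)
  fix W and Y Z :: "'e \<Rightarrow> 'e" and p v
  assume W: "open W" "smooth_on W Y" "smooth_on W Z" "p \<in> W"
  have "((\<lambda>q. \<theta> q (Y q) \<bullet> \<theta> q (Z q)) has_derivative
     (\<lambda>v. \<theta> p (Y p) \<bullet> frechet_derivative (\<lambda>q. \<theta> q (Z q)) (at p) v
        + frechet_derivative (\<lambda>q. \<theta> q (Y q)) (at p) v \<bullet> \<theta> p (Z p))) (at p)"
    using W by (intro has_derivative_inner)
      (simp_all flip: frechet_derivative_works add: differentiable_coframe)
  from fun_cong[OF frechet_derivative_at[OF this], symmetric]
  show "frechet_derivative (\<lambda>q. \<theta> q (Y q) \<bullet> \<theta> q (Z q)) (at p) v =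
      \<theta> p (frame_connection \<Gamma> p v Y) \<bullet> \<theta> p (Z p) + \<theta> p (Y p) \<bullet> \<theta> p (frame_connection \<Gamma> p v Z)"
    by (simp add: coframe_frame_connection inner_add_left inner_add_right
        assms[of "\<theta> p v" "\<theta> p (Y p)" "\<theta> p (Z p)"])
qed

text \<open>If every \<open>\<Gamma> u\<close> is a derivation of the product \<open>m\<close>, then the tensor with constant components \<open>m\<close>
  is parallel.\<close>
lemma frame_connection_bilinear:
  assumes "bilinear m" and \<Gamma>m: "\<And>u w x. \<Gamma> u (m w x) = m (\<Gamma> u w) x + m w (\<Gamma> u x)"
    and W: "open W" "smooth_on W Y" "smooth_on W Z" "p \<in> W"
  shows "frame_connection \<Gamma> p v (\<lambda>q. E q (m (\<theta> q (Y q)) (\<theta> q (Z q)))) =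
    E p (m (\<theta> p (frame_connection \<Gamma> p v Y)) (\<theta> p (Z p)))
    + E p (m (\<theta> p (Y p)) (\<theta> p (frame_connection \<Gamma> p v Z)))"
proof -
  have bm: "bounded_bilinear m" using assms(1) bilinear_conv_bounded_bilinear by blast
  have "((\<lambda>q. m (\<theta> q (Y q)) (\<theta> q (Z q))) has_derivative
     (\<lambda>v. m (\<theta> p (Y p)) (frechet_derivative (\<lambda>q. \<theta> q (Z q)) (at p) v)
        + m (frechet_derivative (\<lambda>q. \<theta> q (Y q)) (at p) v) (\<theta> p (Z p)))) (at p)"
    using W by (intro bounded_bilinear.FDERIV[OF bm])
      (simp_all flip: frechet_derivative_works add: differentiable_coframe)
  from fun_cong[OF frechet_derivative_at[OF this], symmetric]
  show ?thesis
    unfolding coframe_frame_connection unfolding frame_connection_def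
    by (simp add: \<Gamma>m frame_add bounded_bilinear.add_left[OF bm] bounded_bilinear.add_right[OF bm]
        algebra_simps)
qed

end

section \<open>Coordinates on seven-space\<close>

lemma exhaust_7: "x = 1 \<or> x = 2 \<or> x = 3 \<or> x = 4 \<or> x = 5 \<or> x = 6 \<or> x = 7" for x :: 7
proof (induct x)
  case (of_int z)
  then have "z = 0 \<or> z = 1 \<or> z = 2 \<or> z = 3 \<or> z = 4 \<or> z = 5 \<or> z = 6" by fastforce
  then show ?case by auto
qed

lemma forall_7: "(\<forall>i::7. P i) \<longleftrightarrow> P 1 \<and> P 2 \<and> P 3 \<and> P 4 \<and> P 5 \<and> P 6 \<and> P 7"
  by (metis exhaust_7)

lemma UNIV_7: "(UNIV :: 7 set) = {1, 2, 3, 4, 5, 6, 7}"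
  using exhaust_7 by auto

lemma sum_7: "sum f (UNIV :: 7 set) = f 1 + f 2 + f 3 + f 4 + f 5 + f 6 + f 7"
  unfolding UNIV_7 by (simp add: ac_simps)

lemma vector_7 [simp]:
  "(vector [a, b, c, d, e, f, g] :: ('a::zero)^7) $ 1 = a"
  "(vector [a, b, c, d, e, f, g] :: ('a::zero)^7) $ 2 = b"
  "(vector [a, b, c, d, e, f, g] :: ('a::zero)^7) $ 3 = c"
  "(vector [a, b, c, d, e, f, g] :: ('a::zero)^7) $ 4 = d"
  "(vector [a, b, c, d, e, f, g] :: ('a::zero)^7) $ 5 = e"
  "(vector [a, b, c, d, e, f, g] :: ('a::zero)^7) $ 6 = f"
  "(vector [a, b, c, d, e, f, g] :: ('a::zero)^7) $ 7 = g"
  unfolding vector_def by simp_all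

lemma vec7_eq_iff:
  "u = v \<longleftrightarrow> u $ 1 = v $ 1 \<and> u $ 2 = v $ 2 \<and> u $ 3 = v $ 3 \<and> u $ 4 = v $ 4 \<and>
     u $ 5 = v $ 5 \<and> u $ 6 = v $ 6 \<and> u $ 7 = v $ 7" for u v :: "'a^7"
  by (simp add: vec_eq_iff forall_7)

lemma inner_7: "u \<bullet> v = u $ 1 * v $ 1 + u $ 2 * v $ 2 + u $ 3 * v $ 3 + u $ 4 * v $ 4 +
     u $ 5 * v $ 5 + u $ 6 * v $ 6 + u $ 7 * v $ 7" for u v :: "real^7"
  by (simp add: inner_vec_def sum_7)

lemma smooth_on_component:
  fixes f :: "'e::euclidean_space \<Rightarrow> real^'n"
  shows "open S \<Longrightarrow> smooth_on S f \<Longrightarrow> smooth_on S (\<lambda>x. f x $ i)"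
  by (rule smooth_on_linear_compose[of S "\<lambda>u. u $ i"]) (auto intro: linearI)

lemma smooth_on_vec:
  fixes f :: "'e::euclidean_space \<Rightarrow> real^'n"
  assumes "open S" "\<And>i. smooth_on S (\<lambda>x. f x $ i)"
  shows "smooth_on S f"
proof (rule smooth_on_open_cong[OF assms(1)])
  show "(\<Sum>i\<in>UNIV. (f x $ i) *\<^sub>R axis i 1) = f x" for x
    using basis_expansion[of "f x"] by (simp add: scalar_mult_eq_scaleR)
  show "smooth_on S (\<lambda>x. \<Sum>i\<in>UNIV. (f x $ i) *\<^sub>R (axis i 1 :: real^'n))"
    by (intro smooth_on_sum smooth_on_scaleR smooth_on_const assms)
qed

lemma has_derivative_vec:
  fixes f :: "'e::real_normed_vector \<Rightarrow> real^'n"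
  assumes "\<And>i. ((\<lambda>x. f x $ i) has_derivative (\<lambda>v. f' v $ i)) (at p)"
  shows "(f has_derivative f') (at p)"
  unfolding has_derivative_componentwise_within[of f]
  using assms by (auto simp: Basis_vec_def inner_axis)

lemma smooth_on_vector_7:
  assumes "open S" "smooth_on S f1" "smooth_on S f2" "smooth_on S f3" "smooth_on S f4"
    "smooth_on S f5" "smooth_on S f6" "smooth_on S f7"
  shows "smooth_on S (\<lambda>x. vector [f1 x, f2 x, f3 x, f4 x, f5 x, f6 x, f7 x] :: real^7)"
proof (rule smooth_on_vec[OF assms(1)])
  show "smooth_on S (\<lambda>x. (vector [f1 x, f2 x, f3 x, f4 x, f5 x, f6 x, f7 x] :: real^7) $ i)" for i
    using exhaust_7[of i] assms by (elim disjE) simp_all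
qed

section \<open>A solvable Lie group of dimension seven\<close>

text \<open>The left-invariant fields, in the coordinates which assign to \<open>x\<close> the group element
  \<open>exp(x\<^sub>1e\<^sub>1) exp(x\<^sub>2f\<^sub>2) exp(x\<^sub>3f\<^sub>3) exp(x\<^sub>4f\<^sub>4) exp(x\<^sub>6e\<^sub>6/6) exp(x\<^sub>7e\<^sub>7/6) exp(x\<^sub>5e\<^sub>5)\<close> with
  \<open>f\<^sub>2 = e\<^sub>2 + e\<^sub>5/2\<close>, \<open>f\<^sub>3 = e\<^sub>3 + e\<^sub>6\<close>, \<open>f\<^sub>4 = e\<^sub>4 + e\<^sub>7/3\<close>. Since \<open>e\<^sub>1\<close> is the only direction that is not
  nilpotent, putting its factor first makes the fields polynomial. The last three
  factors form the Heisenberg group integrating the vertical distribution, so that the first four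
  coordinates are coordinates on its leaf space. In these the invariant horizontal volume
  is the standard one.\<close>
definition frame :: "real^7 \<Rightarrow> real^7 \<Rightarrow> real^7" where
  "frame x u = vector [
     u$1,
     u$2 + 4 * x$2 * u$1,
     u$3 + (x$6 + 2 * x$3) * u$1 + x$7 * u$2,
     u$4 + (x$7 + 6 * x$4) * u$1 - (x$6 + 12 * x$3) * u$2,
     u$5 - x$7 * u$6 + (x$6 * x$6 / 6 - x$7 * x$7 / 2 - 1 / 2) * u$2
       + x$6 * u$4 / 3 + x$6 * x$7 * u$1 / 3,
     6 * u$6 - 6 * u$3 - 6 * x$6 * u$1,
     6 * u$7 - 2 * u$4 - 2 * x$7 * u$1 - 4 * x$6 * u$2]"

text \<open>The components of \<open>v\<close> in the frame, found by solving the triangular system \<open>frame x u = v\<close>.\<close>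
definition coframe :: "real^7 \<Rightarrow> real^7 \<Rightarrow> real^7" where
  "coframe x v = (let
     u1 = v$1;
     u2 = v$2 - 4 * x$2 * u1;
     u3 = v$3 - (x$6 + 2 * x$3) * u1 - x$7 * u2;
     u4 = v$4 - (x$7 + 6 * x$4) * u1 + (x$6 + 12 * x$3) * u2;
     u6 = v$6 / 6 + u3 + x$6 * u1;
     u7 = v$7 / 6 + u4 / 3 + x$7 * u1 / 3 + 2 * x$6 * u2 / 3;
     u5 = v$5 + x$7 * u6 - (x$6 * x$6 / 6 - x$7 * x$7 / 2 - 1 / 2) * u2
       - x$6 * u4 / 3 - x$6 * x$7 * u1 / 3
   in vector [u1, u2, u3, u4, u5, u6, u7])"

text \<open>The Lie algebra is a semidirect product: \<open>e\<^sub>1\<close> and \<open>e\<^sub>2 + e\<^sub>5/2\<close> span a Borel subalgebra of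
  \<open>sl(2)\<close>, and \<open>e\<^sub>3, e\<^sub>4, e\<^sub>6, e\<^sub>7\<close> together with the central \<open>e\<^sub>5\<close> span the Heisenberg algebra
  of its representation on binary cubics. The parts of components 5 to 7 that involve only the
  indices 1 to 4 are minus twice the standard triple of self-dual 2-forms on
  \<open>\<real>\<^sup>4\<close>, as the contact condition demands.\<close>
definition bracket :: "real^7 \<Rightarrow> real^7 \<Rightarrow> real^7" where
  "bracket u v = (let d = (\<lambda>i j. u$i * v$j - u$j * v$i) in vector [
     0,
     - 4 * d 1 2,
     4 * d 1 3 + 2 * d 2 4 - 6 * d 1 6 - 6 * d 2 7,
     - 4 * d 1 4 + 6 * d 2 3 + 6 * d 2 6 - 6 * d 1 7,
     - 2 * d 1 2 - 2 * d 3 4 + 6 * d 6 7,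
     - 2 * d 1 3 + 2 * d 2 4 - 6 * d 2 7,
     - 2 * d 1 4 - 2 * d 2 3 + 6 * d 2 6])"

text \<open>The quaternionic multiplication on the first four components by the imaginary quaternion with
  coordinates \<open>w\<^sub>5, w\<^sub>6, w\<^sub>7\<close>. Writing the three complex structures as one bilinear map makes \<open>quat\<close>
  also the identification of vertical vectors with endomorphisms.\<close>
definition quat :: "real^7 \<Rightarrow> real^7 \<Rightarrow> real^7" where
  "quat w x = vector [
     - w$5 * x$2 - w$6 * x$3 - w$7 * x$4,
       w$5 * x$1 + w$6 * x$4 - w$7 * x$3,
     - w$5 * x$4 + w$6 * x$1 + w$7 * x$2,
       w$5 * x$3 - w$6 * x$2 + w$7 * x$1, 0, 0, 0]"

text \<open>The Biquard connection in the frame. Its defining conditions leave no choice: for horizontal \<open>X\<close>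
  and vertical \<open>\<xi>\<close>, the torsion condition on horizontal vectors gives \<open>\<Gamma>\<^sub>X\<close> on \<open>H\<close> by the
  Koszul formula with the horizontal part of the bracket; since \<open>T(\<xi>,X)\<close> must be horizontal and
  symmetric in \<open>X\<close>, \<open>\<Gamma>\<^sub>X\<xi>\<close> is the vertical part of \<open>[X,\<xi>]\<close> and \<open>\<Gamma>\<^sub>\<xi>\<close> on \<open>H\<close> is the skew
  part of \<open>ad \<xi>\<close>; finally \<open>\<Gamma>\<^sub>\<xi>\<close> on \<open>V\<close> follows from its commutators with the complex structures.\<close>
definition christoffel :: "real^7 \<Rightarrow> real^7 \<Rightarrow> real^7" where
  "christoffel u v = vector [
     - 4 * u$2 * v$2 + 4 * u$3 * v$3 - 4 * u$4 * v$4 - 3 * u$6 * v$3 - 3 * u$7 * v$4,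
     4 * u$2 * v$1 + 4 * u$3 * v$4 + 4 * u$4 * v$3 + 3 * u$6 * v$4 - 3 * u$7 * v$3,
     - 2 * u$2 * v$4 - 4 * u$3 * v$1 - 4 * u$4 * v$2 + 3 * u$6 * v$1 + 3 * u$7 * v$2,
     2 * u$2 * v$3 - 4 * u$3 * v$2 + 4 * u$4 * v$1 - 3 * u$6 * v$2 + 3 * u$7 * v$1,
     6 * u$6 * v$7 - 6 * u$7 * v$6,
     - 6 * u$2 * v$7 + 6 * u$7 * v$5,
     6 * u$2 * v$6 - 6 * u$6 * v$5]"

lemma bilinear_quat: "bilinear quat"
  unfolding bilinear_def
  by (intro conjI allI; rule linearI; simp add: vec7_eq_iff quat_def algebra_simps)

lemma bilinear_christoffel: "bilinear christoffel"
  unfolding bilinear_def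
  by (intro conjI allI; rule linearI; simp add: vec7_eq_iff christoffel_def algebra_simps)

lemma christoffel_skew: "christoffel u v \<bullet> w = - (v \<bullet> christoffel u w)"
  by (simp add: inner_7 christoffel_def algebra_simps)

text \<open>The identification of \<open>V\<close> with the bundle of endomorphisms is parallel.\<close>
lemma christoffel_quat:
  "christoffel u (quat w x) = quat (christoffel u w) x + quat w (christoffel u x)"
  by (simp add: vec7_eq_iff quat_def christoffel_def algebra_simps)

interpretation qc: invariant_frame frame coframe bracket
proof (rule invariant_frame.intro)
  show "linear (frame p)" for p
    by (rule linearI) (simp_all add: vec7_eq_iff frame_def algebra_simps add_divide_distrib)
  show "coframe p (frame p u) = u" for p u
    by (simp add: vec7_eq_iff frame_def coframe_def Let_def field_simps)
  show "frame p (coframe p u) = u" for p u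
    by (simp add: vec7_eq_iff frame_def coframe_def Let_def field_simps)
  note sm = smooth_on_vector_7 smooth_on_add smooth_on_mult smooth_on_diff
    smooth_on_divide_const smooth_on_const smooth_on_component[OF _ smooth_on_ident] open_UNIV
  show "smooth_on UNIV (\<lambda>q. frame q u)" for u
    unfolding frame_def by (intro sm)
  show "smooth_on UNIV (\<lambda>q. coframe q v)" for v
    unfolding coframe_def Let_def by (intro sm)
  show "frechet_derivative (\<lambda>q. frame q v) (at p) (frame p u)
      - frechet_derivative (\<lambda>q. frame q u) (at p) (frame p v) = frame p (bracket u v)" for p u v
  proof -
    \<comment> \<open>the directional derivative of the frame at \<open>p\<close>, component by component\<close>
    let ?D = "\<lambda>u w. vector [
       0,
       4 * w$2 * u$1,
       (w$6 + 2 * w$3) * u$1 + w$7 * u$2,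
       (w$7 + 6 * w$4) * u$1 - (w$6 + 12 * w$3) * u$2,
       - w$7 * u$6 + (p$6 * w$6 / 3 - p$7 * w$7) * u$2 + w$6 * u$4 / 3
         + (w$6 * p$7 + p$6 * w$7) * u$1 / 3,
       - 6 * w$6 * u$1,
       - 2 * w$7 * u$1 - 4 * w$6 * u$2] :: real^7"
    have "((\<lambda>q. frame q u) has_derivative ?D u) (at p)" for u
    proof (rule has_derivative_vec)
      show "((\<lambda>q. frame q u $ i) has_derivative (\<lambda>w. ?D u w $ i)) (at p)" for i
        using exhaust_7[of i]
        by (elim disjE) (auto simp: frame_def field_simps
            intro!: derivative_eq_intros
              bounded_linear.has_derivative[OF bounded_linear_vec_nth has_derivative_ident])
    qed
    from fun_cong[OF frechet_derivative_at[OF this], symmetric]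
    have D: "frechet_derivative (\<lambda>q. frame q u) (at p) w = ?D u w" for u w .
    show ?thesis
      unfolding D by (simp add: vec7_eq_iff frame_def bracket_def Let_def field_simps)
  qed
qed

section \<open>The quaternionic contact structure\<close>

definition horiz :: "(real^7) set" where
  "horiz = {u. u$5 = 0 \<and> u$6 = 0 \<and> u$7 = 0}"

definition vert :: "(real^7) set" where
  "vert = {u. u$1 = 0 \<and> u$2 = 0 \<and> u$3 = 0 \<and> u$4 = 0}"

text \<open>The constant components of the Reeb fields, the last three basis vectors.\<close>
definition vunit :: "nat \<Rightarrow> real^7" where
  "vunit r = vector [0, 0, 0, 0, of_bool (r = 1), of_bool (r = 2), of_bool (r = 3)]"

definition hdist :: "real^7 \<Rightarrow> (real^7) set" where
  "hdist p = {v. coframe p v \<in> horiz}"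

definition vdist :: "real^7 \<Rightarrow> (real^7) set" where
  "vdist p = {v. coframe p v \<in> vert}"

definition qc_metric :: "real^7 \<Rightarrow> real^7 \<Rightarrow> real^7 \<Rightarrow> real" where
  "qc_metric p v w = coframe p v \<bullet> coframe p w"

definition ident :: "real^7 \<Rightarrow> real^7 \<Rightarrow> real^7 \<Rightarrow> real^7" where
  "ident p v X = frame p (quat (coframe p v) (coframe p X))"

definition reeb :: "nat \<Rightarrow> real^7 \<Rightarrow> real^7" where
  "reeb r p = frame p (vunit r)"

definition acs :: "nat \<Rightarrow> real^7 \<Rightarrow> real^7 \<Rightarrow> real^7" where
  "acs r p = ident p (reeb r p)"

definition contact_form :: "nat \<Rightarrow> real^7 \<Rightarrow> (real^7) list \<Rightarrow> real" where
  "contact_form r p vs = vunit r \<bullet> coframe p (vs ! 0)"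

definition quat_bundle :: "real^7 \<Rightarrow> (real^7 \<Rightarrow> real^7) set" where
  "quat_bundle p = {B. \<exists>a :: nat \<Rightarrow> real. \<forall>X\<in>hdist p. B X = (\<Sum>r\<in>{1,2,3}. a r *\<^sub>R acs r p X)}"

lemma subspace_horiz: "subspace horiz"
  unfolding horiz_def subspace_def by simp

lemma subspace_vert: "subspace vert"
  unfolding vert_def subspace_def by simp

lemma dim_horiz: "dim horiz = 4"
proof -
  define d :: "(real^7) set" where "d = (\<lambda>i. axis i 1) ` {1, 2, 3, 4}"
  have "(\<forall>b\<in>Basis. P b) \<longleftrightarrow> (\<forall>i. P (axis i 1))" for P :: "real^7 \<Rightarrow> bool"
    by (auto simp: Basis_vec_def)
  then have "horiz = {x. \<forall>b\<in>Basis. b \<notin> d \<longrightarrow> x \<bullet> b = 0}"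
    by (simp add: horiz_def d_def forall_7 inner_axis axis_eq_axis)
  moreover have "d \<subseteq> Basis" unfolding d_def by auto
  moreover have "card d = 4"
    unfolding d_def by (subst card_image) (auto simp: inj_on_def axis_eq_axis)
  ultimately show ?thesis using dim_substandard[of d] by simp
qed

lemma hdist_eq_image: "hdist p = frame p ` horiz"
proof
  show "hdist p \<subseteq> frame p ` horiz"
    using imageI[of "coframe p _" horiz "frame p"] by (auto simp: hdist_def)
qed (auto simp: hdist_def)

lemma subspace_hdist: "subspace (hdist p)"
  unfolding hdist_eq_image by (rule linear_subspace_image[OF qc.linear_frame subspace_horiz])

lemma dim_hdist: "dim (hdist p) = 4"
proof -
  have "inj (frame p)" by (metis injI qc.coframe_frame)
  then show ?thesis
    unfolding hdist_eq_image
    by (subst dim_image_eq[OF qc.linear_frame]) (auto intro: inj_on_subset simp: dim_horiz)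
qed

lemma quat_horiz: "quat w x \<in> horiz"
  by (simp add: quat_def horiz_def)

lemma coframe_ident [simp]: "coframe p (ident p v X) = quat (coframe p v) (coframe p X)"
  unfolding ident_def by simp

lemma coframe_reeb [simp]: "coframe p (reeb r p) = vunit r"
  unfolding reeb_def by simp

lemma quat_relations:
  assumes "x \<in> horiz"
  shows "r \<in> {1, 2, 3} \<Longrightarrow> quat (vunit r) (quat (vunit r) x) = - x"
    and "quat (vunit 1) (quat (vunit 2) x) = quat (vunit 3) x"
    and "quat (vunit 2) (quat (vunit 1) x) = - quat (vunit 3) x"
    and "quat (vunit 1) (quat (vunit 2) (quat (vunit 3) x)) = - x"
  using assms by (auto simp: vec7_eq_iff quat_def vunit_def horiz_def)

lemma acs_eq: "acs r p X = frame p (quat (vunit r) (coframe p X))"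
  unfolding acs_def ident_def by simp

lemma quat_linear_combination:
  "(\<Sum>r\<in>{1,2,3}. a r *\<^sub>R acs r p X) = frame p (quat (vector [0, 0, 0, 0, a 1, a 2, a 3]) (coframe p X))"
proof -
  have "quat (vector [0, 0, 0, 0, a 1, a 2, a 3]) x =
      a 1 *\<^sub>R quat (vunit 1) x + a 2 *\<^sub>R quat (vunit 2) x + a 3 *\<^sub>R quat (vunit 3) x" for x
    by (simp add: quat_def vunit_def vec7_eq_iff)
  then show ?thesis by (simp add: acs_eq qc.frame_add qc.frame_scale)
qed

lemma proj_hdist: "proj_along (hdist p) (vdist p) v =
   frame p (vector [coframe p v $ 1, coframe p v $ 2, coframe p v $ 3, coframe p v $ 4, 0, 0, 0])"
  unfolding proj_along_def
proof (rule the_equality)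
  fix w assume "w \<in> hdist p \<and> v - w \<in> vdist p"
  then have "coframe p w = vector [coframe p v $ 1, coframe p v $ 2, coframe p v $ 3, coframe p v $ 4, 0, 0, 0]"
    by (simp add: hdist_def vdist_def horiz_def vert_def qc.coframe_diff vec7_eq_iff)
  then show "w = frame p (vector [coframe p v $ 1, coframe p v $ 2, coframe p v $ 3, coframe p v $ 4, 0, 0, 0])"
    by (simp add: qc.eq_frame_iff)
qed (simp add: hdist_def vdist_def horiz_def vert_def qc.coframe_diff)

lemma proj_vdist: "proj_along (vdist p) (hdist p) v =
   frame p (vector [0, 0, 0, 0, coframe p v $ 5, coframe p v $ 6, coframe p v $ 7])"
  unfolding proj_along_def
proof (rule the_equality)
  fix w assume "w \<in> vdist p \<and> v - w \<in> hdist p"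
  then have "coframe p w = vector [0, 0, 0, 0, coframe p v $ 5, coframe p v $ 6, coframe p v $ 7]"
    by (simp add: hdist_def vdist_def horiz_def vert_def qc.coframe_diff vec7_eq_iff)
  then show "w = frame p (vector [0, 0, 0, 0, coframe p v $ 5, coframe p v $ 6, coframe p v $ 7])"
    by (simp add: qc.eq_frame_iff)
qed (simp add: hdist_def vdist_def horiz_def vert_def qc.coframe_diff)

lemma ext_deriv_contact_form:
  "ext_deriv std_atlas (contact_form r) p [u, v] = - (vunit r \<bullet> bracket (coframe p u) (coframe p v))"
  using qc.ext_deriv_coframe[of "\<lambda>u. vunit r \<bullet> u" p u v]
  unfolding contact_form_def[abs_def] by (simp add: bounded_linear.linear[OF bounded_linear_inner_right])

lemma smooth_on_quat_field:
  assumes "open W" "smooth_on W \<zeta>" "smooth_on W X"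
  shows "smooth_on W (\<lambda>q. ident q (\<zeta> q) (X q))"
proof -
  have "bounded_bilinear quat"
    using bilinear_quat bilinear_conv_bounded_bilinear by blast
  from smooth_on_bounded_bilinear[OF this assms(1)] show ?thesis
    unfolding ident_def
    by (rule qc.smooth_on_frame[OF assms(1)])
      (rule qc.smooth_on_coframe[OF assms(1)] assms)+
qed

lemma smooth_on_reeb: "smooth_on W (reeb r)"
  unfolding reeb_def[abs_def] by (rule smooth_on_subset[OF subset_UNIV qc.smooth_frame])

lemma smooth_endo_acs: "smooth_endo euclidean std_atlas hdist UNIV (acs r)"
proof -
  have "endo_on (hdist q) (acs r q)" for q
    unfolding endo_on_def
    by (auto simp: acs_eq hdist_def quat_horiz qc.coframe_add qc.coframe_scale bilinear_radd[OF bilinear_quat]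
        bilinear_rmul[OF bilinear_quat] qc.frame_add qc.frame_scale)
  then show ?thesis
    unfolding smooth_endo_def smooth_section_def smooth_vf_std acs_def
    using smooth_on_quat_field smooth_on_reeb by auto
qed

lemma smooth_contact_form: "smooth_form euclidean std_atlas UNIV 1 (contact_form r)"
proof -
  have "alternating_form 1 (contact_form r q)" for q
    unfolding alternating_form_def
  proof (intro allI impI conjI)
    fix vs :: "(real^7) list" and i :: nat
    assume "length vs = 1" "i < 1"
    then show "linear (\<lambda>v. contact_form r q (vs[i := v]))"
      by (intro linearI) (simp_all add: contact_form_def qc.coframe_add qc.coframe_scale inner_add_right)
  qed auto
  moreover have "smooth_on UNIV (\<lambda>q. contact_form r q vs)" for vs
    unfolding contact_form_def
    by (intro smooth_on_inner smooth_on_const qc.smooth_coframe) simp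
  ultimately show ?thesis unfolding smooth_form_std by simp
qed

lemma qc_frame_model:
  "qc_frame euclidean std_atlas hdist qc_metric quat_bundle UNIV contact_form acs"
proof -
  have 1: "hdist q = {v. \<forall>r\<in>{1,2,3}. contact_form r q [v] = 0}" for q
    by (auto simp: hdist_def horiz_def contact_form_def vunit_def inner_7)
  have 2: "\<forall>X\<in>hdist q. (\<forall>r\<in>{1,2,3}. acs r q (acs r q X) = - X) \<and>
      acs 1 q (acs 2 q X) = acs 3 q X \<and> acs 2 q (acs 1 q X) = - acs 3 q X \<and>
      acs 1 q (acs 2 q (acs 3 q X)) = - X" for q
    using quat_relations[of "coframe q _"] by (simp add: acs_eq hdist_def qc.frame_neg)
  have 3: "qc_metric q (acs r q X) (acs r q Y) = qc_metric q X Y \<and>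
      2 * qc_metric q (acs r q X) Y = ext_deriv std_atlas (contact_form r) q [X, Y]"
    if "r \<in> {1,2,3}" "X \<in> hdist q" "Y \<in> hdist q" for q r X Y
    using that
    by (auto simp: ext_deriv_contact_form qc_metric_def acs_eq inner_7 quat_def vunit_def bracket_def
        Let_def hdist_def horiz_def algebra_simps)
  show ?thesis
    unfolding qc_frame_def
    using 1 2 3 smooth_contact_form smooth_endo_acs quat_bundle_def by simp
qed

lemma inner_product_metric: "inner_product_on S (qc_metric p)"
proof -
  have "qc_metric p x x > 0" if "x \<noteq> 0" for x
    using that qc.frame_eq_iff[of p 0 x] by (simp add: qc_metric_def)
  moreover have "qc_metric p x y = qc_metric p y x" for x y
    unfolding qc_metric_def by (rule inner_commute)
  ultimately show ?thesis
    unfolding inner_product_on_def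
    by (simp add: qc_metric_def qc.coframe_add qc.coframe_scale inner_add_left)
qed

lemma reeb_frame_model:
  "reeb_frame euclidean std_atlas hdist qc_metric quat_bundle UNIV contact_form acs reeb"
  unfolding reeb_frame_def smooth_vf_std
proof (intro conjI ballI)
  fix q s k X assume sk: "s \<in> {1,2,3::nat}" "k \<in> {1,2,3::nat}"
  then show "contact_form s q [reeb k q] = (if s = k then 1 else 0)"
    by (auto simp: contact_form_def vunit_def inner_7)
  assume X: "X \<in> hdist q"
  show "ext_deriv std_atlas (contact_form s) q [reeb s q, X] = 0"
    "ext_deriv std_atlas (contact_form k) q [reeb s q, X] =
      - ext_deriv std_atlas (contact_form s) q [reeb k q, X]"
    using sk X
    by (auto simp: ext_deriv_contact_form vunit_def inner_7 bracket_def Let_def hdist_def horiz_def)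
qed (simp_all add: qc_frame_model smooth_on_reeb)

lemma integrable_model: "integrable_qc_structure euclidean std_atlas hdist qc_metric quat_bundle"
proof -
  have "smooth_on W (\<lambda>q. qc_metric q (X q) (Y q))" if "open W" "smooth_on W X" "smooth_on W Y" for W X Y
    unfolding qc_metric_def using that by (intro smooth_on_inner qc.smooth_on_coframe)
  then show ?thesis
    unfolding integrable_qc_structure_def qc_structure_def smooth_section_def
    using smooth_manifold_std subspace_hdist dim_hdist inner_product_metric qc_frame_model reeb_frame_model
    by auto
qed

lemma vdist_eq_span: "vdist p = span {reeb 1 p, reeb 2 p, reeb 3 p}"
proof -
  have "subspace (vdist p)"
    using subspace_vert unfolding vdist_def subspace_def
    by (simp add: qc.coframe_add qc.coframe_scale)
  moreover have "{reeb 1 p, reeb 2 p, reeb 3 p} \<subseteq> vdist p"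
    by (auto simp: vdist_def vert_def vunit_def)
  ultimately have "span {reeb 1 p, reeb 2 p, reeb 3 p} \<subseteq> vdist p" by (rule span_minimal[rotated])
  moreover have "v \<in> span {reeb 1 p, reeb 2 p, reeb 3 p}" if "v \<in> vdist p" for v
  proof -
    have "v = coframe p v $ 5 *\<^sub>R reeb 1 p + coframe p v $ 6 *\<^sub>R reeb 2 p + coframe p v $ 7 *\<^sub>R reeb 3 p"
    proof -
      have "coframe p v = coframe p v $ 5 *\<^sub>R vunit 1 + coframe p v $ 6 *\<^sub>R vunit 2 + coframe p v $ 7 *\<^sub>R vunit 3"
        using that by (simp add: vec7_eq_iff vunit_def vdist_def vert_def)
      then have "frame p (coframe p v) = frame p (coframe p v $ 5 *\<^sub>R vunit 1 + coframe p v $ 6 *\<^sub>R vunit 2 + coframe p v $ 7 *\<^sub>R vunit 3)"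
        by simp
      then show ?thesis by (simp add: reeb_def qc.frame_add qc.frame_scale)
    qed
    then show ?thesis
      by (metis insertCI span_add span_base span_scale)
  qed
  ultimately show ?thesis by blast
qed

lemma vertical_model: "vertical_distribution euclidean std_atlas hdist qc_metric quat_bundle vdist"
  unfolding vertical_distribution_def using reeb_frame_model vdist_eq_span by blast

lemma extended_metric_model: "extended_metric euclidean std_atlas hdist qc_metric quat_bundle qc_metric"
proof -
  have "qc_metric q (reeb r q) X = 0" if "X \<in> hdist q" for q r X
    using that by (simp add: qc_metric_def inner_7 vunit_def hdist_def horiz_def)
  moreover have "qc_metric q (reeb r q) (reeb k q) = (if r = k then 1 else 0)"
    if "r \<in> {1,2,3}" "k \<in> {1,2,3}" for q r k
    using that by (auto simp: qc_metric_def inner_7 vunit_def)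
  ultimately show ?thesis
    unfolding extended_metric_def
    by (intro ballI exI[of _ UNIV] exI[of _ contact_form] exI[of _ acs] exI[of _ reeb] conjI)
      (simp_all add: reeb_frame_model inner_product_metric)
qed

lemma natural_identification_model:
  "natural_identification euclidean std_atlas hdist qc_metric quat_bundle ident"
proof -
  have "ident q (\<Sum>r\<in>{1,2,3}. a r *\<^sub>R reeb r q) X = (\<Sum>r\<in>{1,2,3}. a r *\<^sub>R acs r q X)" for q a X
    unfolding ident_def acs_def
    by (simp add: qc.coframe_add qc.coframe_scale bilinear_ladd[OF bilinear_quat]
        bilinear_lmul[OF bilinear_quat] qc.frame_add qc.frame_scale)
  then show ?thesis
    unfolding natural_identification_def
    by (intro ballI exI[of _ UNIV] exI[of _ contact_form] exI[of _ acs] exI[of _ reeb] conjI)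
      (simp_all add: reeb_frame_model)
qed

section \<open>The fundamental 4-form\<close>

text \<open>Expansion of an alternating sum along one position, as for determinants. Iterating it evaluates
  sums over permutations of an explicit set.\<close>
lemma sum_permutes_insert_signed:
  fixes h :: "('a \<Rightarrow> 'a) \<Rightarrow> real"
  assumes "finite S" "a \<notin> S"
  shows "(\<Sum>\<pi> | \<pi> permutes insert a S. of_int (sign \<pi>) * h \<pi>) =
    (\<Sum>b\<in>insert a S. (if a = b then 1 else -1) *
       (\<Sum>\<pi> | \<pi> permutes S. of_int (sign \<pi>) * h (Transposition.transpose a b \<circ> \<pi>)))"
proof -
  have "sign (Transposition.transpose a b \<circ> \<pi>) = (if a = b then 1 else -1) * sign \<pi>" if "\<pi> permutes S" for b \<pi>
    using that assms(1) permutation_permutes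
    by (subst sign_compose) (auto simp: sign_swap_id permutation_swap_id)
  then have "(\<Sum>\<pi> | \<pi> permutes S. of_int (sign (Transposition.transpose a b \<circ> \<pi>)) * h (Transposition.transpose a b \<circ> \<pi>)) =
      (\<Sum>\<pi> | \<pi> permutes S. (if a = b then 1 else -1) * (of_int (sign \<pi>) * h (Transposition.transpose a b \<circ> \<pi>)))" for b
    by (intro sum.cong) (auto simp: mult.assoc)
  then show ?thesis
    unfolding sum_over_permutations_insert[OF assms] by (simp add: sum_distrib_left)
qed

text \<open>The 24 permutations fall into three classes of eight, one for each way to split the four
  arguments into two pairs.\<close>
lemma wedge_2_2:
  fixes w :: "'e \<Rightarrow> 'e \<Rightarrow> real"
  assumes "\<And>u v. w u v = - w v u"
  shows "wedge 2 2 (\<lambda>vs. w (vs ! 0) (vs ! 1)) (\<lambda>vs. w (vs ! 0) (vs ! 1)) [v0, v1, v2, v3] =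
    2 * (w v0 v1 * w v2 v3 - w v0 v2 * w v1 v3 + w v0 v3 * w v1 v2)"
proof -
  let ?h = "\<lambda>\<pi>. w ([v0, v1, v2, v3] ! \<pi> 0) ([v0, v1, v2, v3] ! \<pi> 1)
      * w ([v0, v1, v2, v3] ! \<pi> 2) ([v0, v1, v2, v3] ! \<pi> (3::nat))"
  have S: "{..<2 + 2} = {0, 1, 2, 3::nat}" by auto
  have "wedge 2 2 (\<lambda>vs. w (vs ! 0) (vs ! 1)) (\<lambda>vs. w (vs ! 0) (vs ! 1)) [v0, v1, v2, v3]
      = (\<Sum>\<pi> | \<pi> permutes {0, 1, 2, 3}. of_int (sign \<pi>) * ?h \<pi>) / 4"
    unfolding wedge_def S by (simp add: upt_rec mult.assoc)
  also have "\<dots> = 2 * (w v0 v1 * w v2 v3 - w v0 v2 * w v1 v3 + w v0 v3 * w v1 v2)"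
    using assms[of v1 v0] assms[of v2 v0] assms[of v3 v0] assms[of v2 v1] assms[of v3 v1] assms[of v3 v2]
    by (simp add: sum_permutes_insert_signed Transposition.transpose_def field_simps)
  finally show ?thesis .
qed

definition fund_form :: "real^7 \<Rightarrow> (real^7) list \<Rightarrow> real" where
  "fund_form p vs = (\<Sum>r\<in>{1,2,3}. wedge 2 2 (kahler_form hdist vdist qc_metric (acs r) p)
     (kahler_form hdist vdist qc_metric (acs r) p) vs)"

lemma kahler_form_model:
  "kahler_form hdist vdist qc_metric (acs r) p =
    (\<lambda>vs. quat (vunit r) (coframe p (vs ! 0)) \<bullet> coframe p (vs ! 1))"
  unfolding kahler_form_def proj_hdist by (simp add: acs_eq qc_metric_def inner_7 quat_def)

lemma fund_form_eq:
  "fund_form p [a, b, c, d] =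
    (\<Sum>r\<in>{1,2,3}. 2 * ((quat (vunit r) (coframe p a) \<bullet> coframe p b) * (quat (vunit r) (coframe p c) \<bullet> coframe p d)
       - (quat (vunit r) (coframe p a) \<bullet> coframe p c) * (quat (vunit r) (coframe p b) \<bullet> coframe p d)
       + (quat (vunit r) (coframe p a) \<bullet> coframe p d) * (quat (vunit r) (coframe p b) \<bullet> coframe p c)))"
  unfolding fund_form_def kahler_form_model
  by (intro sum.cong refl wedge_2_2[where w = "\<lambda>u v. quat (vunit _) (coframe p u) \<bullet> coframe p v"])
    (simp add: inner_7 quat_def algebra_simps)

text \<open>The determinant of the first four components, in its Laplace expansion by \<open>2 \<times> 2\<close> minors. This is
  the form in which squares of self-dual 2-forms produce it.\<close>
definition hvol :: "real^7 \<Rightarrow> real^7 \<Rightarrow> real^7 \<Rightarrow> real^7 \<Rightarrow> real" where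
  "hvol a b c d = (let m = (\<lambda>i j u v. u$i * v$j - u$j * v$i) in
     m 1 2 a b * m 3 4 c d + m 3 4 a b * m 1 2 c d
     - m 1 2 a c * m 3 4 b d - m 3 4 a c * m 1 2 b d
     + m 1 2 a d * m 3 4 b c + m 3 4 a d * m 1 2 b c)"

text \<open>The self-dual forms \<open>\<omega>\<^sub>r\<close> of an oriented Euclidean 4-space all have the same square, twice
  the volume form.\<close>
lemma kahler_square_eq_hvol:
  assumes "r \<in> {1, 2, 3}"
  shows "(quat (vunit r) a \<bullet> b) * (quat (vunit r) c \<bullet> d) - (quat (vunit r) a \<bullet> c) * (quat (vunit r) b \<bullet> d)
      + (quat (vunit r) a \<bullet> d) * (quat (vunit r) b \<bullet> c) = hvol a b c d"
proof -
  consider "r = 1" | "r = 2" | "r = 3" using assms by blast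
  then show ?thesis
    by cases (simp_all add: inner_7 quat_def vunit_def hvol_def Let_def algebra_simps)
qed

text \<open>Shears have determinant one.\<close>
lemma hvol_shear:
  shows "(\<And>u. f u $ 1 = u $ 1 \<and> f u $ 2 = u $ 2 + k * u $ 1 \<and> f u $ 3 = u $ 3 \<and> f u $ 4 = u $ 4)
      \<Longrightarrow> hvol (f a) (f b) (f c) (f d) = hvol a b c d"
    and "(\<And>u. f u $ 1 = u $ 1 \<and> f u $ 2 = u $ 2 \<and> f u $ 3 = u $ 3 + k * u $ 1 + l * u $ 2 \<and> f u $ 4 = u $ 4)
      \<Longrightarrow> hvol (f a) (f b) (f c) (f d) = hvol a b c d"
    and "(\<And>u. f u $ 1 = u $ 1 \<and> f u $ 2 = u $ 2 \<and> f u $ 3 = u $ 3 \<and> f u $ 4 = u $ 4 + k * u $ 1 + l * u $ 2)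
      \<Longrightarrow> hvol (f a) (f b) (f c) (f d) = hvol a b c d"
  unfolding hvol_def Let_def by (simp_all add: algebra_simps)

text \<open>On the first four components the coframe is the composition of three shears. Hence the invariant
  horizontal volume form has constant coefficients in the coordinates, which is why it is closed.\<close>
lemma hvol_coframe: "hvol (coframe p a) (coframe p b) (coframe p c) (coframe p d) = hvol a b c d"
proof -
  define s2 where "s2 u = (vector [u$1, u$2 - 4 * p$2 * u$1, u$3, u$4, 0, 0, 0] :: real^7)" for u :: "real^7"
  define s3 where "s3 u = (vector [u$1, u$2, u$3 - (p$6 + 2 * p$3) * u$1 - p$7 * u$2, u$4, 0, 0, 0] :: real^7)"
    for u :: "real^7"
  define s4 where "s4 u = (vector [u$1, u$2, u$3, u$4 - (p$7 + 6 * p$4) * u$1 + (p$6 + 12 * p$3) * u$2, 0, 0, 0] :: real^7)"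
    for u :: "real^7"
  have "hvol (coframe p a) (coframe p b) (coframe p c) (coframe p d) =
      hvol (s4 (s3 (s2 a))) (s4 (s3 (s2 b))) (s4 (s3 (s2 c))) (s4 (s3 (s2 d)))"
    by (simp add: hvol_def Let_def coframe_def s2_def s3_def s4_def)
  also have "\<dots> = hvol (s3 (s2 a)) (s3 (s2 b)) (s3 (s2 c)) (s3 (s2 d))"
    by (rule hvol_shear(3)[of s4 "- (p$7 + 6 * p$4)" "p$6 + 12 * p$3"])
      (simp add: s4_def algebra_simps)
  also have "\<dots> = hvol (s2 a) (s2 b) (s2 c) (s2 d)"
    by (rule hvol_shear(2)[of s3 "- (p$6 + 2 * p$3)" "- p$7"]) (simp add: s3_def algebra_simps)
  also have "\<dots> = hvol a b c d"
    by (rule hvol_shear(1)[of s2 "- 4 * p$2"]) (simp add: s2_def algebra_simps)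
  finally show ?thesis .
qed

lemma fund_form_eq_hvol: "fund_form p [a, b, c, d] = 6 * hvol a b c d"
proof -
  have "fund_form p [a, b, c, d] = (\<Sum>r\<in>{1, 2, 3::nat}. 2 * hvol a b c d)"
    unfolding fund_form_eq by (intro sum.cong refl) (simp only: kahler_square_eq_hvol hvol_coframe)
  then show ?thesis by simp
qed

lemma length_4_cases:
  assumes "length vs = 4" obtains a b c d where "vs = [a, b, c, d]"
  using assms by (auto simp: numeral_eq_Suc length_Suc_conv)

lemma closed_fund_form: "closed_form euclidean std_atlas 4 fund_form"
  unfolding closed_form_def ext_deriv_std
proof (intro ballI allI impI sum.neutral)
  fix p :: "real^7" and vs :: "(real^7) list" and i
  assume vs: "length vs = Suc 4" and i: "i \<in> {..<length vs}"
  then have "length (take i vs @ drop (Suc i) vs) = 4" by simp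
  then obtain a b c d where "take i vs @ drop (Suc i) vs = [a, b, c, d]" by (rule length_4_cases)
  then show "(- 1) ^ i * frechet_derivative (\<lambda>q. fund_form q (take i vs @ drop (Suc i) vs)) (at p) (vs ! i) = 0"
    by (simp add: fund_form_eq_hvol)
qed

lemma fundamental_form_model:
  "fundamental_form euclidean std_atlas hdist qc_metric quat_bundle vdist fund_form"
  unfolding fundamental_form_def
  by (intro ballI exI[of _ UNIV] exI[of _ contact_form] exI[of _ acs] conjI)
    (simp_all add: qc_frame_model fund_form_def)

section \<open>The Biquard connection\<close>

abbreviation biquard :: "real^7 \<Rightarrow> real^7 \<Rightarrow> (real^7 \<Rightarrow> real^7) \<Rightarrow> real^7" where
  "biquard \<equiv> qc.frame_connection christoffel"

lemma christoffel_horiz: "x \<in> horiz \<Longrightarrow> christoffel u x \<in> horiz"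
  by (simp add: horiz_def christoffel_def)

lemma christoffel_vert: "x \<in> vert \<Longrightarrow> christoffel u x \<in> vert"
  by (simp add: vert_def christoffel_def)

lemmas torsion_biquard = qc.torsion_frame_connection[OF bilinear_christoffel]
lemmas linear_biquard = qc.linear_connection_frame[OF bilinear_christoffel]

text \<open>The components of a horizontal field take values in a subspace, hence so do their derivatives, and
  the vertical part of the bracket of two such fields comes from the structure constants only.\<close>
lemma torsion_horizontal:
  assumes "smooth_section euclidean std_atlas hdist W X" "smooth_section euclidean std_atlas hdist W Y" "p \<in> W"
  shows "torsion euclidean std_atlas biquard p (X p) (Y p)
    = - proj_along (vdist p) (hdist p) (lie_bracket std_atlas X Y p)"
proof -
  have W: "open W" "smooth_on W X" "smooth_on W Y"
    and h: "\<And>q. q \<in> W \<Longrightarrow> coframe q (X q) \<in> horiz" "\<And>q. q \<in> W \<Longrightarrow> coframe q (Y q) \<in> horiz"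
    using assms unfolding smooth_section_def hdist_def by auto
  have D: "frechet_derivative (\<lambda>q. coframe q (Z q)) (at p) v \<in> horiz"
    if "smooth_on W Z" "\<And>q. q \<in> W \<Longrightarrow> coframe q (Z q) \<in> horiz" for Z v
    using qc.frechet_derivative_in_subspace[OF subspace_horiz W(1) assms(3)
        qc.differentiable_coframe[OF W(1) that(1) assms(3)] that(2)] .
  let ?x = "coframe p (X p)" and ?y = "coframe p (Y p)"
  have "christoffel ?x ?y - christoffel ?y ?x - bracket ?x ?y =
    - vector [0, 0, 0, 0, bracket ?x ?y $ 5, bracket ?x ?y $ 6, bracket ?x ?y $ 7]"
    using h[OF assms(3)]
    by (simp add: vec7_eq_iff christoffel_def bracket_def Let_def horiz_def algebra_simps)
  then show ?thesis
    using D[OF W(2) h(1)] D[OF W(3) h(2)]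
    unfolding torsion_biquard proj_vdist qc.lie_bracket_frame[OF W assms(3)]
    by (simp add: horiz_def flip: qc.frame_neg)
qed

text \<open>Minus the symmetric part of the action of the vertical vector \<open>u\<close> on \<open>H\<close> by the bracket.\<close>
definition htorsion :: "real^7 \<Rightarrow> real^7 \<Rightarrow> real^7" where
  "htorsion u x = vector [
     - 3 * u$6 * x$3 - 3 * u$7 * x$4, 3 * u$6 * x$4 - 3 * u$7 * x$3,
     - 3 * u$6 * x$1 - 3 * u$7 * x$2, 3 * u$6 * x$2 - 3 * u$7 * x$1, 0, 0, 0]"

lemma torsion_endomorphism:
  assumes "\<xi> \<in> vdist p" "X \<in> hdist p"
  shows "torsion euclidean std_atlas biquard p \<xi> X = frame p (htorsion (coframe p \<xi>) (coframe p X))"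
proof -
  have "christoffel u x - christoffel x u - bracket u x = htorsion u x"
    if "u \<in> vert" "x \<in> horiz" for u x
    using that by (simp add: vec7_eq_iff christoffel_def bracket_def htorsion_def Let_def
        horiz_def vert_def algebra_simps)
  then show ?thesis using assms unfolding torsion_biquard vdist_def hdist_def by simp
qed

lemma quat_bundle_skew:
  assumes "B \<in> quat_bundle p" "X \<in> hdist p" "Y \<in> hdist p"
  shows "qc_metric p (B X) Y = - qc_metric p X (B Y)"
proof -
  obtain a where "\<forall>X\<in>hdist p. B X = (\<Sum>r\<in>{1,2,3}. a r *\<^sub>R acs r p X)"
    using assms(1) unfolding quat_bundle_def by blast
  then have "coframe p (B X) = quat (vector [0, 0, 0, 0, a 1, a 2, a 3]) (coframe p X)"
    "coframe p (B Y) = quat (vector [0, 0, 0, 0, a 1, a 2, a 3]) (coframe p Y)"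
    using assms(2,3) unfolding quat_linear_combination by simp_all
  then show ?thesis by (simp add: qc_metric_def inner_7 quat_def algebra_simps)
qed

definition hframe :: "real^7 \<Rightarrow> nat \<Rightarrow> real^7" where
  "hframe p i = frame p (vector [of_bool (i = 0), of_bool (i = 1), of_bool (i = 2), of_bool (i = 3), 0, 0, 0])"

lemma hframe_mem_hdist: "hframe p i \<in> hdist p"
  by (simp add: hframe_def hdist_def horiz_def)

text \<open>Both copies of \<open>sp(1)\<close> consist of skew endomorphisms, and the torsion is symmetric, so the
  pairing vanishes term against transposed term.\<close>
lemma torsion_perp:
  assumes \<xi>: "\<xi> \<in> vdist p"
  shows "torsion euclidean std_atlas biquard p \<xi> \<in>
     gl_perp (hdist p) (qc_metric p)
       {\<lambda>X. B X + C X |B C. B \<in> quat_bundle p \<and> C \<in> sp1_commuting hdist qc_metric quat_bundle p}"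
proof -
  let ?T = "torsion euclidean std_atlas biquard p \<xi>"
  let ?u = "coframe p \<xi>"
  have T: "coframe p (?T X) = htorsion ?u (coframe p X)" if "X \<in> hdist p" for X
    by (simp add: torsion_endomorphism[OF \<xi> that])
  have endo: "endo_on (hdist p) ?T"
  proof -
    have h: "htorsion u x \<in> horiz" "htorsion u (x + y) = htorsion u x + htorsion u y"
      "htorsion u (r *\<^sub>R x) = r *\<^sub>R htorsion u x" for u x y r
      by (simp_all add: htorsion_def horiz_def vec7_eq_iff algebra_simps)
    show ?thesis
      unfolding endo_on_def
      using subspace_hdist[of p]
      by (auto simp: torsion_endomorphism[OF \<xi>] subspace_add subspace_scale h qc.coframe_add
          qc.coframe_scale qc.frame_add qc.frame_scale) (simp add: hdist_def h)
  qed
  note e = hframe_mem_hdist[of p]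
  have orth: "(\<Sum>i<4. qc_metric p (?T (hframe p i)) (S (hframe p i))) = 0"
    if S: "\<And>X Y. X \<in> hdist p \<Longrightarrow> Y \<in> hdist p \<Longrightarrow> qc_metric p (S X) Y = - qc_metric p X (S Y)" for S
  proof -
    have sk: "coframe p (S (hframe p i)) \<bullet> coframe p (hframe p j) =
        - (coframe p (hframe p i) \<bullet> coframe p (S (hframe p j)))" for i j
      using S[OF e e] unfolding qc_metric_def .
    show ?thesis
      using sk[of 0 2] sk[of 0 3] sk[of 1 2] sk[of 1 3]
      by (simp add: qc_metric_def T[OF e] numeral_eq_Suc lessThan_Suc)
        (simp add: htorsion_def hframe_def inner_7 algebra_simps)
  qed
  have "(\<Sum>i<4. qc_metric p (?T (hframe p i)) (S (hframe p i))) = 0"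
    if S': "S \<in> {\<lambda>X. B X + C X |B C. B \<in> quat_bundle p \<and> C \<in> sp1_commuting hdist qc_metric quat_bundle p}" for S
  proof -
    obtain B C where S: "S = (\<lambda>X. B X + C X)" and B: "B \<in> quat_bundle p"
      and C: "C \<in> sp1_commuting hdist qc_metric quat_bundle p"
      using S' by blast
    have "qc_metric p (C X) Y = - qc_metric p X (C Y)" if "X \<in> hdist p" "Y \<in> hdist p" for X Y
      using C that unfolding sp1_commuting_def by blast
    with quat_bundle_skew[OF B] show ?thesis
      by (intro orth) (simp add: S qc_metric_def qc.coframe_add inner_add_left inner_add_right)
  qed
  moreover have "qc_metric p (hframe p i) (hframe p j) = (if i = j then 1 else 0)" if "i < 4" "j < 4" for i j
    using that by (auto simp: qc_metric_def hframe_def inner_7)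
  ultimately show ?thesis
    unfolding gl_perp_def using endo e by blast
qed

lemma biquard_ident:
  assumes "open W" "smooth_on W \<zeta>" "smooth_on W X" "p \<in> W"
  shows "biquard p v (\<lambda>q. ident q (\<zeta> q) (X q)) = ident p (biquard p v \<zeta>) (X p) + ident p (\<zeta> p) (biquard p v X)"
  unfolding ident_def
  by (rule qc.frame_connection_bilinear[where m = quat and \<Gamma> = christoffel, OF bilinear_quat christoffel_quat assms])

lemma parallel_identification_model:
  "parallel_identification euclidean std_atlas biquard hdist vdist ident"
  unfolding parallel_identification_def smooth_section_def smooth_vf_std endo_cov_deriv_def
proof (intro allI impI ballI, elim conjE)
  fix W and \<zeta> X :: "real^7 \<Rightarrow> real^7" and p v
  assume "open W" "smooth_on W \<zeta>" "smooth_on W X" "p \<in> W"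
  from biquard_ident[OF this, of v]
  show "biquard p v (\<lambda>q. ident q (\<zeta> q) (X q)) - ident p (\<zeta> p) (biquard p v X) = ident p (biquard p v \<zeta>) (X p)"
    by simp
qed

lemma ident_mem_quat_bundle: "ident p w \<in> quat_bundle p"
proof -
  let ?a = "\<lambda>r :: nat. if r = 1 then coframe p w $ 5 else if r = 2 then coframe p w $ 6 else coframe p w $ 7"
  have "quat (coframe p w) x = quat (vector [0, 0, 0, 0, ?a 1, ?a 2, ?a 3]) x" for x
    by (simp add: quat_def)
  then have "\<forall>X\<in>hdist p. ident p w X = (\<Sum>r\<in>{1,2,3}. ?a r *\<^sub>R acs r p X)"
    unfolding quat_linear_combination ident_def by metis
  then show ?thesis unfolding quat_bundle_def by (intro CollectI exI)
qed

lemma preserves_hdist: "preserves_distribution euclidean std_atlas biquard hdist"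
  using qc.preserves_distribution_frame[OF subspace_horiz christoffel_horiz]
  unfolding hdist_def[abs_def] .

lemma preserves_vdist: "preserves_distribution euclidean std_atlas biquard vdist"
  using qc.preserves_distribution_frame[OF subspace_vert christoffel_vert]
  unfolding vdist_def[abs_def] .

text \<open>Sections of the bundle of endomorphisms come from vertical fields. The coefficients of
  \<open>\<sigma> = \<Sum> a\<^sub>r I\<^sub>r\<close> are read off as the components of \<open>\<sigma> e\<^sub>1 = a\<^sub>1 e\<^sub>2 + a\<^sub>2 e\<^sub>3 + a\<^sub>3 e\<^sub>4\<close>, which
  shows that they are smooth.\<close>
lemma quat_bundle_section:
  assumes "smooth_endo euclidean std_atlas hdist W \<sigma>" "\<And>q. q \<in> W \<Longrightarrow> \<sigma> q \<in> quat_bundle q"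
  obtains \<zeta> where "smooth_on W \<zeta>" "\<And>q X. q \<in> W \<Longrightarrow> X \<in> hdist q \<Longrightarrow> \<sigma> q X = ident q (\<zeta> q) X"
proof -
  define s where "s q = \<sigma> q (hframe q 0)" for q
  define z where "z q = (vector [0, 0, 0, 0, coframe q (s q) $ 2, coframe q (s q) $ 3, coframe q (s q) $ 4] :: real^7)" for q
  have W: "open W" using assms(1) unfolding smooth_endo_def by simp
  have e: "smooth_section euclidean std_atlas hdist W (\<lambda>q. hframe q 0)"
    unfolding smooth_section_def hframe_def
    using W smooth_on_subset[OF subset_UNIV qc.smooth_frame] by (simp add: hdist_def horiz_def)
  have "smooth_on W s"
    using assms(1) e unfolding smooth_endo_def s_def by auto
  then have "smooth_on W z"
    unfolding z_def
    by (intro smooth_on_vector_7[OF W] smooth_on_const smooth_on_component[OF W] qc.smooth_on_coframe[OF W])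
  then have "smooth_on W (\<lambda>q. frame q (z q))" by (rule qc.smooth_on_frame[OF W])
  moreover have "\<sigma> q X = ident q (frame q (z q)) X" if q: "q \<in> W" and X: "X \<in> hdist q" for q X
  proof -
    obtain a where a: "\<And>X. X \<in> hdist q \<Longrightarrow> \<sigma> q X = (\<Sum>r\<in>{1,2,3}. a r *\<^sub>R acs r q X)"
      using assms(2)[OF q] unfolding quat_bundle_def mem_Collect_eq by metis
    have h0: "hframe q 0 \<in> hdist q" using e q unfolding smooth_section_def by blast
    have "z q = vector [0, 0, 0, 0, a 1, a 2, a 3]"
      unfolding z_def s_def a[OF h0] quat_linear_combination by (simp add: quat_def hframe_def)
    then show ?thesis
      unfolding a[OF X] quat_linear_combination ident_def by simp
  qed
  ultimately show ?thesis by (rule that)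
qed

text \<open>Since the identification is parallel, the derivative of the endomorphism that corresponds to a
  vertical field corresponds to the derivative of this field.\<close>
lemma preserves_quat_bundle: "preserves_endo_bundle euclidean std_atlas biquard hdist quat_bundle"
  unfolding preserves_endo_bundle_def
proof (intro allI impI ballI)
  fix W and \<sigma> :: "real^7 \<Rightarrow> real^7 \<Rightarrow> real^7" and p v
  assume \<sigma>: "smooth_endo euclidean std_atlas hdist W \<sigma> \<and> (\<forall>q\<in>W. \<sigma> q \<in> quat_bundle q)" and p: "p \<in> W"
  then obtain \<zeta> where \<zeta>: "smooth_on W \<zeta>"
    "\<And>q X. q \<in> W \<Longrightarrow> X \<in> hdist q \<Longrightarrow> \<sigma> q X = ident q (\<zeta> q) X"
    using quat_bundle_section by blast
  show "\<exists>B\<in>quat_bundle p. \<forall>W' X. p \<in> W' \<and> W' \<subseteq> W \<and> smooth_section euclidean std_atlas hdist W' X \<longrightarrow>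
      endo_cov_deriv biquard p v \<sigma> X = B (X p)"
  proof (intro bexI allI impI)
    fix W' and X :: "real^7 \<Rightarrow> real^7" assume *: "p \<in> W' \<and> W' \<subseteq> W \<and> smooth_section euclidean std_atlas hdist W' X"
    then have X: "open W'" "smooth_on W' X" "\<And>q. q \<in> W' \<Longrightarrow> X q \<in> hdist q" "p \<in> W'" "W' \<subseteq> W"
      unfolding smooth_section_def by auto
    have \<zeta>': "smooth_on W' \<zeta>" using \<zeta>(1) X(5) smooth_on_subset by blast
    have i: "smooth_on W' (\<lambda>q. ident q (\<zeta> q) (X q))"
      by (rule smooth_on_quat_field[OF X(1) \<zeta>' X(2)])
    have eq: "ident q (\<zeta> q) (X q) = \<sigma> q (X q)" if "q \<in> W'" for q
      using \<zeta>(2) X(3,5) that by auto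
    have "biquard p v (\<lambda>q. \<sigma> q (X q)) = biquard p v (\<lambda>q. ident q (\<zeta> q) (X q))"
      by (rule qc.frame_connection_cong[OF X(1) i eq X(4), symmetric])
    moreover have "biquard p v X \<in> hdist p"
      using preserves_hdist * unfolding preserves_distribution_def by blast
    ultimately show "endo_cov_deriv biquard p v \<sigma> X = ident p (biquard p v \<zeta>) (X p)"
      unfolding endo_cov_deriv_def using \<zeta>(2)[OF p] biquard_ident[OF X(1) \<zeta>' X(2,4)] by simp
  qed (rule ident_mem_quat_bundle)
qed

lemma biquard_model:
  "biquard_connection euclidean std_atlas hdist qc_metric quat_bundle vdist qc_metric ident biquard"
  unfolding biquard_connection_def
proof (intro conjI allI impI ballI)
  show "parallel_metric euclidean std_atlas biquard qc_metric"
    using qc.parallel_metric_frame[OF christoffel_skew] unfolding qc_metric_def[abs_def] .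
qed (auto intro: torsion_horizontal torsion_perp linear_biquard preserves_hdist preserves_vdist
  preserves_quat_bundle parallel_identification_model)

lemma reeb_mem_vdist: "reeb r p \<in> vdist p"
  by (simp add: vdist_def vert_def vunit_def)

text \<open>The witnesses reflect the bracket \<open>[e\<^sub>6, e\<^sub>1] = 6 e\<^sub>3\<close>, which is not matched by a component of
  \<open>[e\<^sub>6, e\<^sub>3]\<close> along \<open>e\<^sub>1\<close>.\<close>
lemma torsion_nonzero: "torsion euclidean std_atlas biquard p (reeb 2 p) (hframe p 0) \<noteq> 0"
  by (simp add: torsion_endomorphism reeb_mem_vdist hframe_mem_hdist qc.frame_eq_iff)
    (simp add: vec7_eq_iff htorsion_def vunit_def hframe_def)

theorem theorem1p1:
  "\<exists>(M :: (real^7) topology) (A :: (real^7, real^7) chart set) H g Q V G \<phi> \<Omega> nab.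
     integrable_qc_structure M A H g Q \<and>
     vertical_distribution M A H g Q V \<and>
     extended_metric M A H g Q G \<and>
     natural_identification M A H g Q \<phi> \<and>
     fundamental_form M A H g Q V \<Omega> \<and>
     closed_form M A 4 \<Omega> \<and>
     biquard_connection M A H g Q V G \<phi> nab \<and>
     (\<exists>p\<in>topspace M. \<exists>\<xi>\<in>V p. \<exists>X\<in>H p. torsion M A nab p \<xi> X \<noteq> 0)"
proof (intro exI conjI)
  show "\<exists>p\<in>topspace euclidean. \<exists>\<xi>\<in>vdist p. \<exists>X\<in>hdist p. torsion euclidean std_atlas biquard p \<xi> X \<noteq> 0"
    using torsion_nonzero[of 0] reeb_mem_vdist[of 2 0] hframe_mem_hdist[of 0 0] by auto
qed (fact integrable_model vertical_model extended_metric_model natural_identification_model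
    fundamental_form_model closed_fund_form biquard_model)+

end
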